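(* For $X\in c\mathrm{Aff}$ (a cosimplicial affine scheme), the canonical morphism $f:X^l\to X$ is a weak equivalence.
   Context: $c\mathrm{Aff}$ is the category of cosimplicial affine schemes, i.e. the opposite of the category of simplicial commutative rings. Write $X=\mathrm{Spec}\,A$ with $A$ a simplicial ring, $X^n=\mathrm{Spec}\,A_n$, and $\pi^0X=\mathrm{Spec}\,\pi_0A$, which maps to every $X^n$ via the canonical maps $A_n\to\pi_0A$. A morphism $\mathrm{Spec}\,B\to\mathrm{Spec}\,A$ in $c\mathrm{Aff}$ is a weak equivalence if $\pi_n(A)\cong\pi_n(B)$ for all $n$. For a morphism $g:V\to W$ of affine schemes, the localisation of $W$ at $V$ is $$(V/W)^{\mathrm{loc}}=\mathrm{Spec}\varinjlim_{g(V)\subset U\subset W,\ U\text{ open}}\Gamma(U,\mathcal O_W).$$ $X^l\in c\mathrm{Aff}$ is defined by $(X^l)^n:=(\pi^0X/X^n)^{\mathrm{loc}}$. *)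

theory Defs
  imports "HOL-Algebra.QuotRing"
begin

section \<open>Simplicial commutative rings\<close>

text \<open>
  The category of cosimplicial affine schemes is by definition the opposite of the category of
  simplicial commutative rings, so an object $X = \mathrm{Spec}\,A$ is represented by $A$ and a
  morphism $\mathrm{Spec}\,B \to \mathrm{Spec}\,A$ by a homomorphism $A \to B$.
  For a simplicial ring \<open>A\<close>, \<open>face A n i\<close> is the face map $d_i : A_{n+1} \to A_n$
  ($i \le n+1$) and \<open>degen A n i\<close> the degeneracy $s_i : A_n \to A_{n+1}$ ($i \le n$); thus
  \<open>n\<close> is always the lower of the two levels. Values at other \<open>i\<close>, or off the carriers, are irrelevant.
\<close>

record 'a sring =
  lev :: "nat \<Rightarrow> 'a ring"
  face :: "nat \<Rightarrow> nat \<Rightarrow> 'a \<Rightarrow> 'a"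
  degen :: "nat \<Rightarrow> nat \<Rightarrow> 'a \<Rightarrow> 'a"

locale simplicial_cring =
  fixes A :: "'a sring"
  assumes lev_cring: "cring (lev A n)"
    and face_hom: "i \<le> Suc n \<Longrightarrow> face A n i \<in> ring_hom (lev A (Suc n)) (lev A n)"
    and degen_hom: "i \<le> n \<Longrightarrow> degen A n i \<in> ring_hom (lev A n) (lev A (Suc n))"
    and face_face: "\<lbrakk>i \<le> j; j \<le> Suc n; x \<in> carrier (lev A (Suc (Suc n)))\<rbrakk> \<Longrightarrow>
      face A n i (face A (Suc n) (Suc j) x) = face A n j (face A (Suc n) i x)"
    and degen_degen: "\<lbrakk>i \<le> j; j \<le> n; x \<in> carrier (lev A n)\<rbrakk> \<Longrightarrow>
      degen A (Suc n) i (degen A n j x) = degen A (Suc n) (Suc j) (degen A n i x)"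
    and face_degen_lower: "\<lbrakk>i \<le> j; j \<le> n; x \<in> carrier (lev A (Suc n))\<rbrakk> \<Longrightarrow>
      face A (Suc n) i (degen A (Suc n) (Suc j) x) = degen A n j (face A n i x)"
    and face_degen_same: "\<lbrakk>j \<le> n; x \<in> carrier (lev A n)\<rbrakk> \<Longrightarrow> face A n j (degen A n j x) = x"
    and face_degen_next: "\<lbrakk>j \<le> n; x \<in> carrier (lev A n)\<rbrakk> \<Longrightarrow> face A n (Suc j) (degen A n j x) = x"
    and face_degen_upper: "\<lbrakk>j < i; i \<le> Suc n; x \<in> carrier (lev A (Suc n))\<rbrakk> \<Longrightarrow>
      face A (Suc n) (Suc i) (degen A (Suc n) j x) = degen A n j (face A n i x)"

definition sring_hom :: "'a sring \<Rightarrow> 'b sring \<Rightarrow> (nat \<Rightarrow> 'a \<Rightarrow> 'b) \<Rightarrow> bool" where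
  "sring_hom A B f \<longleftrightarrow>
     (\<forall>n. f n \<in> ring_hom (lev A n) (lev B n)) \<and>
     (\<forall>n i. \<forall>x \<in> carrier (lev A (Suc n)). i \<le> Suc n \<longrightarrow> f n (face A n i x) = face B n i (f (Suc n) x)) \<and>
     (\<forall>n i. \<forall>x \<in> carrier (lev A n). i \<le> n \<longrightarrow> f (Suc n) (degen A n i x) = degen B n i (f n x))"


section \<open>Homotopy groups and weak equivalences\<close>

text \<open>
  $\pi_n(A)$ is the homology in degree $n$ of the normalised (Moore) complex of $A$: an $n$-cycle
  is an $x \in A_n$ all of whose faces vanish (no condition if $n = 0$), and the boundaries are
  the $d_0 y$ with $d_i y = 0$ for all $i > 0$.
\<close>

definition cycles :: "'a sring \<Rightarrow> nat \<Rightarrow> 'a set" where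
  "cycles A n = {x \<in> carrier (lev A n).
     \<forall>m i. n = Suc m \<and> i \<le> n \<longrightarrow> face A m i x = \<zero>\<^bsub>lev A m\<^esub>}"

definition boundaries :: "'a sring \<Rightarrow> nat \<Rightarrow> 'a set" where
  "boundaries A n = face A n 0 `
     {y \<in> carrier (lev A (Suc n)). \<forall>i. 1 \<le> i \<and> i \<le> Suc n \<longrightarrow> face A n i y = \<zero>\<^bsub>lev A n\<^esub>}"

definition homotopy_group :: "'a sring \<Rightarrow> nat \<Rightarrow> 'a set monoid" where
  "homotopy_group A n = (add_monoid (lev A n)\<lparr>carrier := cycles A n\<rparr>) Mod boundaries A n"

definition homotopy_map :: "'b sring \<Rightarrow> (nat \<Rightarrow> 'a \<Rightarrow> 'b) \<Rightarrow> nat \<Rightarrow> 'a set \<Rightarrow> 'b set" where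
  "homotopy_map B f n C = (\<Union>x \<in> C. boundaries B n +>\<^bsub>lev B n\<^esub> f n x)"

text \<open>The morphism $\mathrm{Spec}\,B \to \mathrm{Spec}\,A$ given by $f : A \to B$ is a weak equivalence.\<close>

definition weak_equivalence :: "'a sring \<Rightarrow> 'b sring \<Rightarrow> (nat \<Rightarrow> 'a \<Rightarrow> 'b) \<Rightarrow> bool" where
  "weak_equivalence A B f \<longleftrightarrow>
     simplicial_cring A \<and> simplicial_cring B \<and> sring_hom A B f \<and>
     (\<forall>n. homotopy_map B f n \<in> iso (homotopy_group A n) (homotopy_group B n))"

text \<open>
  The ring $\pi_0 A$ has the same underlying cosets as \<open>homotopy_group A 0\<close>. The canonical map
  $A_n \to \pi_0 A$ takes a vertex and then its class; every vertex gives the same class,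
  and $d_0 \cdots d_0$ is the one used here.
\<close>

definition pi0_ring :: "'a sring \<Rightarrow> 'a set ring" where
  "pi0_ring A = lev A 0 Quot boundaries A 0"

primrec vertex :: "'a sring \<Rightarrow> nat \<Rightarrow> 'a \<Rightarrow> 'a" where
  "vertex A 0 x = x"
| "vertex A (Suc n) x = vertex A n (face A n 0 x)"

definition to_pi0 :: "'a sring \<Rightarrow> nat \<Rightarrow> 'a \<Rightarrow> 'a set" where
  "to_pi0 A n x = boundaries A 0 +>\<^bsub>lev A 0\<^esub> vertex A n x"


section \<open>Affine schemes\<close>

definition Spec :: "'a ring \<Rightarrow> 'a set set" where
  "Spec R = {P. primeideal P R}"

definition zariski_open :: "'a ring \<Rightarrow> 'a set set \<Rightarrow> bool" where
  "zariski_open R U \<longleftrightarrow> (\<exists>J \<subseteq> carrier R. U = {P \<in> Spec R. \<not> J \<subseteq> P})"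

definition Spec_map :: "'a ring \<Rightarrow> ('a \<Rightarrow> 'b) \<Rightarrow> 'b set \<Rightarrow> 'a set" where
  "Spec_map R h Q = {x \<in> carrier R. h x \<in> Q}"

text \<open>
  Localisation of \<open>R\<close> at a multiplicative set \<open>S\<close>: \<open>frac R S a s\<close> is $a/s$, the class of $(a,s)$
  under $(a,s) \sim (b,t) \iff u(at - bs) = 0$ for some $u \in S$.
\<close>

definition frac :: "'a ring \<Rightarrow> 'a set \<Rightarrow> 'a \<Rightarrow> 'a \<Rightarrow> ('a \<times> 'a) set" where
  "frac R S a s = {(b, t). b \<in> carrier R \<and> t \<in> S \<and>
     (\<exists>u \<in> S. u \<otimes>\<^bsub>R\<^esub> (a \<otimes>\<^bsub>R\<^esub> t \<ominus>\<^bsub>R\<^esub> b \<otimes>\<^bsub>R\<^esub> s) = \<zero>\<^bsub>R\<^esub>)}"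

definition frac_ring :: "'a ring \<Rightarrow> 'a set \<Rightarrow> ('a \<times> 'a) set ring" where
  "frac_ring R S =
     \<lparr>carrier = {frac R S a s | a s. a \<in> carrier R \<and> s \<in> S},
      mult = (\<lambda>X Y. \<Union>(a, s) \<in> X. \<Union>(b, t) \<in> Y. frac R S (a \<otimes>\<^bsub>R\<^esub> b) (s \<otimes>\<^bsub>R\<^esub> t)),
      one = frac R S \<one>\<^bsub>R\<^esub> \<one>\<^bsub>R\<^esub>,
      zero = frac R S \<zero>\<^bsub>R\<^esub> \<one>\<^bsub>R\<^esub>,
      add = (\<lambda>X Y. \<Union>(a, s) \<in> X. \<Union>(b, t) \<in> Y.
               frac R S (a \<otimes>\<^bsub>R\<^esub> t \<oplus>\<^bsub>R\<^esub> b \<otimes>\<^bsub>R\<^esub> s) (s \<otimes>\<^bsub>R\<^esub> t))\<rparr>"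

abbreviation stalk_frac :: "'a ring \<Rightarrow> 'a set \<Rightarrow> 'a \<Rightarrow> 'a \<Rightarrow> ('a \<times> 'a) set" where
  "stalk_frac R P a s \<equiv> frac R (carrier R - P) a s"

abbreviation stalk :: "'a ring \<Rightarrow> 'a set \<Rightarrow> ('a \<times> 'a) set ring" where
  "stalk R P \<equiv> frac_ring R (carrier R - P)"

text \<open>
  $\Gamma(U, \mathcal{O}_{\mathrm{Spec}\,R})$: functions sending $P \in U$ to an element of $R_P$ that are
  locally given by one fraction; as functions on all sets they are \<open>undefined\<close> outside \<open>U\<close>.
\<close>

type_synonym 'a regular_fun = "'a set \<Rightarrow> ('a \<times> 'a) set"

definition sections :: "'a ring \<Rightarrow> 'a set set \<Rightarrow> 'a regular_fun ring" where
  "sections R U =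
     \<lparr>carrier = {\<sigma> \<in> (\<Pi>\<^sub>E P \<in> U. carrier (stalk R P)).
        \<forall>P \<in> U. \<exists>V a s. zariski_open R V \<and> P \<in> V \<and> V \<subseteq> U \<and> a \<in> carrier R \<and> s \<in> carrier R \<and>
          (\<forall>Q \<in> V. s \<notin> Q \<and> \<sigma> Q = stalk_frac R Q a s)},
      mult = (\<lambda>\<sigma> \<tau>. \<lambda>P \<in> U. \<sigma> P \<otimes>\<^bsub>stalk R P\<^esub> \<tau> P),
      one = (\<lambda>P \<in> U. \<one>\<^bsub>stalk R P\<^esub>),
      zero = (\<lambda>P \<in> U. \<zero>\<^bsub>stalk R P\<^esub>),
      add = (\<lambda>\<sigma> \<tau>. \<lambda>P \<in> U. \<sigma> P \<oplus>\<^bsub>stalk R P\<^esub> \<tau> P)\<rparr>"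


section \<open>The localisation of an affine scheme along a morphism\<close>

text \<open>
  For a set \<open>Z\<close> of points of $\mathrm{Spec}\,R$, \<open>germs R Z\<close> is the filtered colimit of the rings
  $\Gamma(U, \mathcal{O})$ over the open $U \supseteq Z$: its elements are the classes \<open>germ R Z U \<sigma>\<close>
  of pairs $(U, \sigma)$, two pairs being equivalent if they have the same restriction to some
  smaller open $W \supseteq Z$.
\<close>

definition germ ::
  "'a ring \<Rightarrow> 'a set set \<Rightarrow> 'a set set \<Rightarrow> 'a regular_fun \<Rightarrow> ('a set set \<times> 'a regular_fun) set" where
  "germ R Z U \<sigma> = {(V, \<tau>). zariski_open R V \<and> Z \<subseteq> V \<and> \<tau> \<in> carrier (sections R V) \<and>
     (\<exists>W. zariski_open R W \<and> Z \<subseteq> W \<and> W \<subseteq> U \<inter> V \<and> restrict \<sigma> W = restrict \<tau> W)}"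

definition germs :: "'a ring \<Rightarrow> 'a set set \<Rightarrow> ('a set set \<times> 'a regular_fun) set ring" where
  "germs R Z =
     \<lparr>carrier = {germ R Z U \<sigma> | U \<sigma>. zariski_open R U \<and> Z \<subseteq> U \<and> \<sigma> \<in> carrier (sections R U)},
      mult = (\<lambda>X Y. \<Union>(U, \<sigma>) \<in> X. \<Union>(V, \<tau>) \<in> Y.
        germ R Z (U \<inter> V) (restrict \<sigma> (U \<inter> V) \<otimes>\<^bsub>sections R (U \<inter> V)\<^esub> restrict \<tau> (U \<inter> V))),
      one = germ R Z (Spec R) \<one>\<^bsub>sections R (Spec R)\<^esub>,
      zero = germ R Z (Spec R) \<zero>\<^bsub>sections R (Spec R)\<^esub>,
      add = (\<lambda>X Y. \<Union>(U, \<sigma>) \<in> X. \<Union>(V, \<tau>) \<in> Y.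
        germ R Z (U \<inter> V) (restrict \<sigma> (U \<inter> V) \<oplus>\<^bsub>sections R (U \<inter> V)\<^esub> restrict \<tau> (U \<inter> V)))\<rparr>"

text \<open>
  For $g : V = \mathrm{Spec}\,S \to W = \mathrm{Spec}\,R$ given by $h : R \to S$, \<open>loc_ring R S h\<close> is
  the coordinate ring of $(V/W)^{\mathrm{loc}}$, and \<open>loc_unit R S h\<close> its canonical map from $R$.
\<close>

type_synonym 'a loc_elem = "('a set set \<times> 'a regular_fun) set"

definition loc_ring :: "'a ring \<Rightarrow> 'b ring \<Rightarrow> ('a \<Rightarrow> 'b) \<Rightarrow> 'a loc_elem ring" where
  "loc_ring R S h = germs R (Spec_map R h ` Spec S)"

definition loc_unit :: "'a ring \<Rightarrow> 'b ring \<Rightarrow> ('a \<Rightarrow> 'b) \<Rightarrow> 'a \<Rightarrow> 'a loc_elem" where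
  "loc_unit R S h a =
     germ R (Spec_map R h ` Spec S) (Spec R) (\<lambda>P \<in> Spec R. stalk_frac R P a \<one>\<^bsub>R\<^esub>)"

text \<open>
  Functoriality: a homomorphism $\theta : R \to R'$ over $S$ induces
  $(\mathrm{Spec}\,S/\mathrm{Spec}\,R')^{\mathrm{loc}} \to (\mathrm{Spec}\,S/\mathrm{Spec}\,R)^{\mathrm{loc}}$,
  by pulling sections back along $\mathrm{Spec}\,\theta$.
\<close>

definition stalk_map :: "'b ring \<Rightarrow> ('a \<Rightarrow> 'b) \<Rightarrow> 'b set \<Rightarrow> ('a \<times> 'a) set \<Rightarrow> ('b \<times> 'b) set" where
  "stalk_map R' \<theta> Q X = (\<Union>(a, s) \<in> X. stalk_frac R' Q (\<theta> a) (\<theta> s))"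

definition pull_open :: "'a ring \<Rightarrow> 'b ring \<Rightarrow> ('a \<Rightarrow> 'b) \<Rightarrow> 'a set set \<Rightarrow> 'b set set" where
  "pull_open R R' \<theta> U = {Q \<in> Spec R'. Spec_map R \<theta> Q \<in> U}"

definition pull_section ::
  "'a ring \<Rightarrow> 'b ring \<Rightarrow> ('a \<Rightarrow> 'b) \<Rightarrow> 'a set set \<Rightarrow> 'a regular_fun \<Rightarrow> 'b regular_fun" where
  "pull_section R R' \<theta> U \<sigma> = (\<lambda>Q \<in> pull_open R R' \<theta> U. stalk_map R' \<theta> Q (\<sigma> (Spec_map R \<theta> Q)))"

definition loc_map ::
  "'a ring \<Rightarrow> 'b ring \<Rightarrow> 'c ring \<Rightarrow> ('b \<Rightarrow> 'c) \<Rightarrow> ('a \<Rightarrow> 'b) \<Rightarrow> 'a loc_elem \<Rightarrow> 'b loc_elem" where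
  "loc_map R R' S h' \<theta> X = (\<Union>(U, \<sigma>) \<in> X.
     germ R' (Spec_map R' h' ` Spec S) (pull_open R R' \<theta> U) (pull_section R R' \<theta> U \<sigma>))"


section \<open>The cosimplicial affine scheme $X^l$\<close>

text \<open>For $X = \mathrm{Spec}\,A$: the simplicial ring of $X^l$, and the map inducing $X^l \to X$.\<close>

definition l_sring :: "'a sring \<Rightarrow> 'a loc_elem sring" where
  "l_sring A =
     \<lparr>lev = (\<lambda>n. loc_ring (lev A n) (pi0_ring A) (to_pi0 A n)),
      face = (\<lambda>n i. loc_map (lev A (Suc n)) (lev A n) (pi0_ring A) (to_pi0 A n) (face A n i)),
      degen = (\<lambda>n i. loc_map (lev A n) (lev A (Suc n)) (pi0_ring A) (to_pi0 A (Suc n)) (degen A n i))\<rparr>"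

definition l_unit :: "'a sring \<Rightarrow> nat \<Rightarrow> 'a \<Rightarrow> 'a loc_elem" where
  "l_unit A n = loc_unit (lev A n) (pi0_ring A) (to_pi0 A n)"

end

theory Submission
  imports "HOL-Algebra.Ring_Divisibility" Defs
begin

text \<open>
  Since $A_n \to \pi_0(A)$ is surjective, the points of $\pi^0X$ form a closed subset of $X^n$, and
  the neighbourhoods of a closed subset are exhausted by basic open sets $D(s)$ with
  $s \mapsto 1 \in \pi_0(A)$. Hence $X^l$ is given by the fractions $S_n^{-1}A_n$, where
  $S_n \subseteq A_n$ is the set of elements that become $1$ in $\pi_0(A)$. The degeneracies carry
  $S_n$ into $S_{n+1}$, so denominators can be cleared simultaneously on all faces: every cycle
  (boundary) of $S^{-1}A$ is $y/s$ with $y$ a cycle (boundary) of $A$. It remains to see that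
  $s \in S_n$ acts as the identity on $\pi_n(A)$. A cycle $x$ vanishes on the whole boundary of the
  simplex, so the class of $ax$ depends only on the homotopy class of $a$ as a map from a simplex,
  that is, on the image of $a$ in $\pi_0(A)$.
\<close>

section \<open>Prime ideals and radicals\<close>

text \<open>Two obstacles shape the proof. A section is a family of stalk elements that is a
  fraction only locally, so pointwise facts on Spec must be turned into identities in the ring. The
  device is to express the wanted property by an ideal: either a power of an element lies in it
  because every prime above it contains the element (\<open>nat_pow_in_ideal\<close>), or it
  contains an element mapping to 1 because no prime above the kernel of A_n -> pi_0(A) contains it
  (\<open>ideal_meets_M\<close>). Secondly, the denominators S_n change with n, so pi_n of the
  localisation is not at once a localisation of pi_n(A); the comparison is made on single cycles and
  boundaries. The homotopy invariance of the action on pi_n has this source: for a cycle x of degree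
  n, the only faces of s_j x that can be nonzero are those with index j and j+1, both equal to x.
  Multiplying by c - s_j d_{j+1} c kills face j+1 too and leaves (d_j c - d_{j+1} c) x as the only
  face, so d_j c and d_{j+1} c act alike. Running through the faces of suitable degenerate c
  replaces a by a degeneracy of its vertex.\<close>

lemma (in cring) exists_primeideal_disjoint:
  assumes J: "ideal J R" and S: "submonoid S R" and disj: "J \<inter> S = {}"
  shows "\<exists>P. primeideal P R \<and> J \<subseteq> P \<and> P \<inter> S = {}"
proof -
  interpret S: submonoid S R by (rule S)
  define F where "F = {I. ideal I R \<and> J \<subseteq> I \<and> I \<inter> S = {}}"
  have "\<exists>M\<in>F. \<forall>I\<in>F. M \<subseteq> I \<longrightarrow> I = M"
  proof (rule subset_Zorn)
    fix C assume C: "subset.chain F C"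
    show "\<exists>U\<in>F. \<forall>I\<in>C. I \<subseteq> U"
    proof (cases "C = {}")
      case True
      then show ?thesis using J disj by (auto simp: F_def)
    next
      case False
      have CF: "C \<subseteq> F" using C by (auto simp: subset.chain_def)
      have "subset.chain {I. ideal I R} C"
        using C by (auto simp: subset.chain_def F_def)
      then have "ideal (\<Union>C) R"
        using chain_Union_is_ideal[of C] False by simp
      moreover have "J \<subseteq> \<Union>C" using False CF by (auto simp: F_def)
      moreover have "\<Union>C \<inter> S = {}" using CF by (auto simp: F_def)
      ultimately show ?thesis by (auto simp: F_def)
    qed
  qed
  then obtain M where MF: "M \<in> F" and max': "\<forall>I\<in>F. M \<subseteq> I \<longrightarrow> I = M" by (elim bexE)
  then have M: "ideal M R" "J \<subseteq> M" "M \<inter> S = {}" by (simp_all add: F_def)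
  have max: "I = M" if "ideal I R" "M \<subseteq> I" "I \<inter> S = {}" for I
    using max' that M(2) by (simp add: F_def)
  interpret M: ideal M R by (rule M)
  have meets: "\<exists>m\<in>M. \<exists>x\<in>carrier R. m \<oplus> x \<otimes> a \<in> S" if a: "a \<in> carrier R" "a \<notin> M" for a
  proof (rule ccontr)
    assume no: "\<not> ?thesis"
    have id: "ideal (M <+> PIdl a) R"
      by (intro add_ideals M cgenideal_ideal a)
    have "M \<subseteq> M <+> PIdl a"
    proof
      fix m assume m: "m \<in> M"
      have "m = m \<oplus> \<zero> \<otimes> a" using m a by simp
      then show "m \<in> M <+> PIdl a"
        using m by (auto simp: set_add_defs cgenideal_def)
    qed
    moreover have "(M <+> PIdl a) \<inter> S = {}"
      using no by (auto simp: set_add_defs cgenideal_def)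
    ultimately have "M <+> PIdl a = M" using max id by blast
    moreover have "a \<in> M <+> PIdl a"
      unfolding set_add_def'
    proof (intro UN_I)
      show "a \<in> {\<zero> \<oplus> a}" using a by simp
    qed (use cgenideal_self[OF a(1)] M.zero_closed in auto)
    ultimately show False using a by blast
  qed
  have "primeideal M R"
  proof (rule primeidealI[OF M(1) is_cring])
    show "carrier R \<noteq> M" using M(3) S.one_closed by auto
    fix a b assume ab: "a \<in> carrier R" "b \<in> carrier R" "a \<otimes> b \<in> M"
    show "a \<in> M \<or> b \<in> M"
    proof (rule ccontr)
      assume "\<not> ?thesis"
      then obtain m x m' y where mx: "m \<in> M" "x \<in> carrier R" "m \<oplus> x \<otimes> a \<in> S"
        and my: "m' \<in> M" "y \<in> carrier R" "m' \<oplus> y \<otimes> b \<in> S"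
        using meets ab by metis
      have mc: "m \<in> carrier R" "m' \<in> carrier R" using mx my by auto
      \<comment> \<open>The product of the two elements of \<open>S\<close> lies in
        \<open>S\<close>, and every term of its expansion contains \<open>m\<close>,
        \<open>m'\<close> or the product of \<open>a\<close> and \<open>b\<close>, so it also lies
        in \<open>M\<close>.\<close>
      have "(m \<oplus> x \<otimes> a) \<otimes> (m' \<oplus> y \<otimes> b)
          = (m' \<oplus> y \<otimes> b) \<otimes> m \<oplus> ((x \<otimes> a) \<otimes> m' \<oplus> (x \<otimes> y) \<otimes> (a \<otimes> b))"
        using ab mx(2) my(2) mc by algebra
      also have "\<dots> \<in> M"
        using ab mx(1,2) my(1,2) mc by (simp add: M.I_l_closed)
      finally show False using S.m_closed[OF mx(3) my(3)] M(3) by auto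
    qed
  qed
  then show ?thesis using M by blast
qed

text \<open>The case of the powers of \<open>f\<close> as multiplicative set: the radical of
  \<open>J\<close> is the intersection of the primes above it. This is how vanishing or
  non-vanishing at all points becomes an explicit equation in the ring.\<close>

lemma (in cring) nat_pow_in_ideal:
  assumes J: "ideal J R" and f: "f \<in> carrier R"
    and primes: "\<And>P. \<lbrakk>primeideal P R; J \<subseteq> P\<rbrakk> \<Longrightarrow> f \<in> P"
  shows "\<exists>k::nat. f [^] k \<in> J"
proof (rule ccontr)
  assume "\<not> ?thesis"
  then have disj: "J \<inter> range (\<lambda>k::nat. f [^] k) = {}" by auto
  have "submonoid (range (\<lambda>k::nat. f [^] k)) R"
  proof
    show "range (\<lambda>k::nat. f [^] k) \<subseteq> carrier R" using f by auto
    show "\<one> \<in> range (\<lambda>k::nat. f [^] k)" by (rule range_eqI[of _ _ "0::nat"]) simp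
    fix x y assume "x \<in> range (\<lambda>k::nat. f [^] k)" "y \<in> range (\<lambda>k::nat. f [^] k)"
    then obtain k l :: nat where "x = f [^] k" "y = f [^] l" by blast
    then have "x \<otimes> y = f [^] (k + l)" using f by (simp add: nat_pow_mult)
    then show "x \<otimes> y \<in> range (\<lambda>k::nat. f [^] k)" by blast
  qed
  then obtain P where P: "primeideal P R" "J \<subseteq> P" "P \<inter> range (\<lambda>k::nat. f [^] k) = {}"
    using exists_primeideal_disjoint[OF J _ disj] by blast
  have "f \<in> P" using primes P by blast
  moreover have "f = f [^] (1::nat)" using f by simp
  ultimately show False using P(3) by blast
qed


section \<open>Fractions\<close>

text \<open>Operations on classes are defined as unions over all representatives. A nonempty union
  of equal sets is that set, so what remains to be shown each time is independence of the
  representatives.\<close>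

lemma UN_pair_const:
  assumes "p \<in> X" and eq: "\<And>a s. (a, s) \<in> X \<Longrightarrow> F a s = C"
  shows "(\<Union>(a, s)\<in>X. F a s) = C"
proof -
  have "(case x of (a, s) \<Rightarrow> F a s) = C" if "x \<in> X" for x
    using that eq by (cases x) simp
  moreover have "X \<noteq> {}" using assms(1) by blast
  ultimately show ?thesis by (intro SUP_eq_const)
qed

lemma UN_pair2_const:
  assumes "p \<in> X" "q \<in> Y"
    and "\<And>a s b t. \<lbrakk>(a, s) \<in> X; (b, t) \<in> Y\<rbrakk> \<Longrightarrow> F a s b t = C"
  shows "(\<Union>(a, s)\<in>X. \<Union>(b, t)\<in>Y. F a s b t) = C"
  using assms by (intro UN_pair_const) auto

locale frac_cring = R?: cring R + S: submonoid S R for R :: "'a ring" (structure) and S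
begin

lemma S_carrier [simp, intro]: "s \<in> S \<Longrightarrow> s \<in> carrier R"
  using S.subset by blast

lemma cancel_iff:
  assumes "a \<in> carrier R" "b \<in> carrier R" "s \<in> carrier R" "t \<in> carrier R" "u \<in> carrier R"
  shows "u \<otimes> (a \<otimes> t \<ominus> b \<otimes> s) = \<zero> \<longleftrightarrow> u \<otimes> (a \<otimes> t) = u \<otimes> (b \<otimes> s)"
proof -
  have "u \<otimes> (a \<otimes> t \<ominus> b \<otimes> s) = u \<otimes> (a \<otimes> t) \<ominus> u \<otimes> (b \<otimes> s)"
    using assms by (simp add: minus_eq r_distr r_minus)
  then show ?thesis using assms by (simp add: r_right_minus_eq)
qed

text \<open>The relation inside \<open>frac\<close> without its subtraction (see
  \<open>cancel_iff\<close>), so that identities of fractions can be settled by commutative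
  rewriting.\<close>

definition frac_eq :: "'a \<Rightarrow> 'a \<Rightarrow> 'a \<Rightarrow> 'a \<Rightarrow> bool" where
  "frac_eq a s b t \<longleftrightarrow> (\<exists>u\<in>S. u \<otimes> (a \<otimes> t) = u \<otimes> (b \<otimes> s))"

lemma frac_eqI:
  assumes "a \<otimes> t = b \<otimes> s"
  shows "frac_eq a s b t"
  unfolding frac_eq_def using assms by (intro bexI[of _ \<one>]) auto

lemma frac_eq_sym: "frac_eq a s b t \<Longrightarrow> frac_eq b t a s"
  unfolding frac_eq_def by metis

lemma frac_eq_trans:
  assumes "frac_eq a s b t" "frac_eq b t c r"
    and c: "a \<in> carrier R" "b \<in> carrier R" "c \<in> carrier R" "s \<in> S" "t \<in> S" "r \<in> S"
  shows "frac_eq a s c r"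
proof -
  obtain u v where u: "u \<in> S" "u \<otimes> (a \<otimes> t) = u \<otimes> (b \<otimes> s)"
    and v: "v \<in> S" "v \<otimes> (b \<otimes> r) = v \<otimes> (c \<otimes> t)"
    using assms(1,2) by (auto simp: frac_eq_def)
  \<comment> \<open>The middle denominator \<open>t\<close> cannot be cancelled, so it joins the
    witness.\<close>
  have "(u \<otimes> v \<otimes> t) \<otimes> (a \<otimes> r) = (v \<otimes> r) \<otimes> (u \<otimes> (a \<otimes> t))"
    using c u(1) v(1) by (simp add: m_ac)
  also have "\<dots> = (u \<otimes> s) \<otimes> (v \<otimes> (b \<otimes> r))"
    unfolding u(2) using c u(1) v(1) by (simp add: m_ac)
  also have "\<dots> = (u \<otimes> v \<otimes> t) \<otimes> (c \<otimes> s)"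
    unfolding v(2) using c u(1) v(1) by (simp add: m_ac)
  finally show ?thesis
    unfolding frac_eq_def using c u(1) v(1) by blast
qed

lemma mem_frac_iff:
  assumes "a \<in> carrier R" "s \<in> S"
  shows "(b, t) \<in> frac R S a s \<longleftrightarrow> b \<in> carrier R \<and> t \<in> S \<and> frac_eq a s b t"
  using assms cancel_iff by (auto simp: frac_def frac_eq_def)

lemma frac_self: "\<lbrakk>a \<in> carrier R; s \<in> S\<rbrakk> \<Longrightarrow> (a, s) \<in> frac R S a s"
  by (simp add: mem_frac_iff frac_eqI)

lemma frac_eq_iff:
  assumes "a \<in> carrier R" "b \<in> carrier R" "s \<in> S" "t \<in> S"
  shows "frac R S a s = frac R S b t \<longleftrightarrow> frac_eq a s b t"
proof
  assume "frac R S a s = frac R S b t"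
  then show "frac_eq a s b t"
    using frac_self[OF assms(2,4)] mem_frac_iff assms by metis
next
  assume eq: "frac_eq a s b t"
  have "frac_eq a s c r \<longleftrightarrow> frac_eq b t c r" if "c \<in> carrier R" "r \<in> S" for c r
    using that assms frac_eq_trans[OF eq] frac_eq_trans[OF frac_eq_sym[OF eq]] by blast
  then show "frac R S a s = frac R S b t"
    using assms by (auto simp: mem_frac_iff)
qed

lemma frac_eq_mult:
  assumes "frac_eq a s a' s'" "frac_eq b t b' t'"
    and c: "a \<in> carrier R" "b \<in> carrier R" "s \<in> S" "t \<in> S"
      "a' \<in> carrier R" "b' \<in> carrier R" "s' \<in> S" "t' \<in> S"
  shows "frac_eq (a \<otimes> b) (s \<otimes> t) (a' \<otimes> b') (s' \<otimes> t')"
proof -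
  obtain u v where u: "u \<in> S" "u \<otimes> (a \<otimes> s') = u \<otimes> (a' \<otimes> s)"
    and v: "v \<in> S" "v \<otimes> (b \<otimes> t') = v \<otimes> (b' \<otimes> t)"
    using assms(1,2) by (auto simp: frac_eq_def)
  have "(u \<otimes> v) \<otimes> ((a \<otimes> b) \<otimes> (s' \<otimes> t')) = (u \<otimes> (a \<otimes> s')) \<otimes> (v \<otimes> (b \<otimes> t'))"
    using c u(1) v(1) by (simp add: m_ac)
  also have "\<dots> = (u \<otimes> v) \<otimes> ((a' \<otimes> b') \<otimes> (s \<otimes> t))"
    unfolding u(2) v(2) using c u(1) v(1) by (simp add: m_ac)
  finally show ?thesis unfolding frac_eq_def using u v by blast
qed

lemma frac_eq_add:
  assumes "frac_eq a s a' s'" "frac_eq b t b' t'"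
    and c: "a \<in> carrier R" "b \<in> carrier R" "s \<in> S" "t \<in> S"
      "a' \<in> carrier R" "b' \<in> carrier R" "s' \<in> S" "t' \<in> S"
  shows "frac_eq (a \<otimes> t \<oplus> b \<otimes> s) (s \<otimes> t) (a' \<otimes> t' \<oplus> b' \<otimes> s') (s' \<otimes> t')"
proof -
  obtain u v where u: "u \<in> S" "u \<otimes> (a \<otimes> s') = u \<otimes> (a' \<otimes> s)"
    and v: "v \<in> S" "v \<otimes> (b \<otimes> t') = v \<otimes> (b' \<otimes> t)"
    using assms(1,2) by (auto simp: frac_eq_def)
  have "(u \<otimes> v) \<otimes> ((a \<otimes> t \<oplus> b \<otimes> s) \<otimes> (s' \<otimes> t'))
      = (v \<otimes> t \<otimes> t') \<otimes> (u \<otimes> (a \<otimes> s')) \<oplus> (u \<otimes> s \<otimes> s') \<otimes> (v \<otimes> (b \<otimes> t'))"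
    using c u(1) v(1) by (simp add: r_distr l_distr m_ac)
  also have "\<dots> = (u \<otimes> v) \<otimes> ((a' \<otimes> t' \<oplus> b' \<otimes> s') \<otimes> (s \<otimes> t))"
    unfolding u(2) v(2) using c u(1) v(1) by (simp add: r_distr l_distr m_ac)
  finally show ?thesis unfolding frac_eq_def using u v by blast
qed

lemma frac_ring_mult:
  assumes "a \<in> carrier R" "b \<in> carrier R" "s \<in> S" "t \<in> S"
  shows "frac R S a s \<otimes>\<^bsub>frac_ring R S\<^esub> frac R S b t = frac R S (a \<otimes> b) (s \<otimes> t)"
proof -
  have "frac R S (a' \<otimes> b') (s' \<otimes> t') = frac R S (a \<otimes> b) (s \<otimes> t)"
    if "(a', s') \<in> frac R S a s" "(b', t') \<in> frac R S b t" for a' s' b' t'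
    using that assms by (simp add: mem_frac_iff frac_eq_iff frac_eq_mult frac_eq_sym)
  then show ?thesis
    unfolding frac_ring_def monoid.simps ring.simps
    by (intro UN_pair2_const[OF frac_self[OF assms(1,3)] frac_self[OF assms(2,4)]])
qed

lemma frac_ring_add:
  assumes "a \<in> carrier R" "b \<in> carrier R" "s \<in> S" "t \<in> S"
  shows "frac R S a s \<oplus>\<^bsub>frac_ring R S\<^esub> frac R S b t
    = frac R S (a \<otimes> t \<oplus> b \<otimes> s) (s \<otimes> t)"
proof -
  have "frac R S (a' \<otimes> t' \<oplus> b' \<otimes> s') (s' \<otimes> t') = frac R S (a \<otimes> t \<oplus> b \<otimes> s) (s \<otimes> t)"
    if "(a', s') \<in> frac R S a s" "(b', t') \<in> frac R S b t" for a' s' b' t'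
    using that assms by (simp add: mem_frac_iff frac_eq_iff frac_eq_add frac_eq_sym)
  then show ?thesis
    unfolding frac_ring_def monoid.simps ring.simps
    by (intro UN_pair2_const[OF frac_self[OF assms(1,3)] frac_self[OF assms(2,4)]])
qed

end

text \<open>\<open>G a s\<close> plays the role of $a/s$ in a ring \<open>B\<close> that is a localisation of \<open>R\<close> at \<open>S\<close>.\<close>

locale fraction_presentation = frac_cring R S for R :: "'a ring" (structure) and S +
  fixes B :: "('c, 'd) ring_scheme" and G :: "'a \<Rightarrow> 'a \<Rightarrow> 'c"
  assumes carrier_B: "carrier B = {G a s | a s. a \<in> carrier R \<and> s \<in> S}"
    and G_eq_iff: "\<lbrakk>a \<in> carrier R; b \<in> carrier R; s \<in> S; t \<in> S\<rbrakk>
      \<Longrightarrow> G a s = G b t \<longleftrightarrow> frac_eq a s b t"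
    and G_mult: "\<lbrakk>a \<in> carrier R; b \<in> carrier R; s \<in> S; t \<in> S\<rbrakk>
      \<Longrightarrow> G a s \<otimes>\<^bsub>B\<^esub> G b t = G (a \<otimes> b) (s \<otimes> t)"
    and G_add: "\<lbrakk>a \<in> carrier R; b \<in> carrier R; s \<in> S; t \<in> S\<rbrakk>
      \<Longrightarrow> G a s \<oplus>\<^bsub>B\<^esub> G b t = G (a \<otimes> t \<oplus> b \<otimes> s) (s \<otimes> t)"
    and one_B: "\<one>\<^bsub>B\<^esub> = G \<one> \<one>"
    and zero_B: "\<zero>\<^bsub>B\<^esub> = G \<zero> \<one>"
begin

lemma G_closed [simp, intro]: "\<lbrakk>a \<in> carrier R; s \<in> S\<rbrakk> \<Longrightarrow> G a s \<in> carrier B"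
  using carrier_B by blast

lemma G_cases:
  assumes "x \<in> carrier B"
  obtains a s where "a \<in> carrier R" "s \<in> S" "x = G a s"
  using assms carrier_B by blast

lemma G_eqI:
  "\<lbrakk>a \<otimes> t = b \<otimes> s; a \<in> carrier R; b \<in> carrier R; s \<in> S; t \<in> S\<rbrakk> \<Longrightarrow> G a s = G b t"
  by (simp add: G_eq_iff frac_eqI)

text \<open>All ring laws are computed with fractions over \<open>R\<close>. For the ring of germs
  this replaces a proof that sections over an open set form a ring and that restriction is
  compatible with the operations.\<close>

lemma cring_B: "cring B"
proof (rule cringI)
  show "abelian_group B"
  proof (rule abelian_groupI)
    fix x y assume "x \<in> carrier B" "y \<in> carrier B"
    then show "x \<oplus>\<^bsub>B\<^esub> y \<in> carrier B"
      by (elim G_cases) (simp add: G_add)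
  next
    show "\<zero>\<^bsub>B\<^esub> \<in> carrier B" by (simp add: zero_B)
  next
    fix x y z assume "x \<in> carrier B" "y \<in> carrier B" "z \<in> carrier B"
    then show "x \<oplus>\<^bsub>B\<^esub> y \<oplus>\<^bsub>B\<^esub> z = x \<oplus>\<^bsub>B\<^esub> (y \<oplus>\<^bsub>B\<^esub> z)"
      by (elim G_cases) (simp add: G_add, rule G_eqI; simp add: l_distr r_distr m_ac a_ac)
  next
    fix x y assume "x \<in> carrier B" "y \<in> carrier B"
    then show "x \<oplus>\<^bsub>B\<^esub> y = y \<oplus>\<^bsub>B\<^esub> x"
      by (elim G_cases) (simp add: G_add m_ac a_ac)
  next
    fix x assume "x \<in> carrier B"
    then show "\<zero>\<^bsub>B\<^esub> \<oplus>\<^bsub>B\<^esub> x = x"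
      by (elim G_cases) (simp add: G_add zero_B)
  next
    fix x assume "x \<in> carrier B"
    then obtain a s where "a \<in> carrier R" "s \<in> S" "x = G a s" by (rule G_cases)
    then have "G (\<ominus> a) s \<oplus>\<^bsub>B\<^esub> x = \<zero>\<^bsub>B\<^esub>"
      by (simp add: G_add zero_B, intro G_eqI; simp add: l_minus l_neg)
    then show "\<exists>y\<in>carrier B. y \<oplus>\<^bsub>B\<^esub> x = \<zero>\<^bsub>B\<^esub>"
      using \<open>a \<in> carrier R\<close> \<open>s \<in> S\<close> by (intro bexI[of _ "G (\<ominus> a) s"]) auto
  qed
next
  show "Group.comm_monoid B"
  proof (rule comm_monoidI)
    fix x y assume "x \<in> carrier B" "y \<in> carrier B"
    then show "x \<otimes>\<^bsub>B\<^esub> y \<in> carrier B"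
      by (elim G_cases) (simp add: G_mult)
  next
    show "\<one>\<^bsub>B\<^esub> \<in> carrier B" by (simp add: one_B)
  next
    fix x y z assume "x \<in> carrier B" "y \<in> carrier B" "z \<in> carrier B"
    then show "x \<otimes>\<^bsub>B\<^esub> y \<otimes>\<^bsub>B\<^esub> z = x \<otimes>\<^bsub>B\<^esub> (y \<otimes>\<^bsub>B\<^esub> z)"
      by (elim G_cases) (simp add: G_mult m_ac)
  next
    fix x y assume "x \<in> carrier B" "y \<in> carrier B"
    then show "x \<otimes>\<^bsub>B\<^esub> y = y \<otimes>\<^bsub>B\<^esub> x"
      by (elim G_cases) (simp add: G_mult m_ac)
  next
    fix x assume "x \<in> carrier B"
    then show "\<one>\<^bsub>B\<^esub> \<otimes>\<^bsub>B\<^esub> x = x"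
      by (elim G_cases) (simp add: G_mult one_B)
  qed
next
  fix x y z assume "x \<in> carrier B" "y \<in> carrier B" "z \<in> carrier B"
  then show "(x \<oplus>\<^bsub>B\<^esub> y) \<otimes>\<^bsub>B\<^esub> z = x \<otimes>\<^bsub>B\<^esub> z \<oplus>\<^bsub>B\<^esub> y \<otimes>\<^bsub>B\<^esub> z"
    by (elim G_cases) (simp add: G_mult G_add, rule G_eqI; simp add: l_distr r_distr m_ac a_ac)
qed

lemma G_eq_zero_iff:
  assumes "a \<in> carrier R" "s \<in> S"
  shows "G a s = \<zero>\<^bsub>B\<^esub> \<longleftrightarrow> (\<exists>u\<in>S. u \<otimes> a = \<zero>)"
  using assms by (simp add: zero_B G_eq_iff frac_eq_def cong: bex_cong)

lemma G_of_one_hom: "(\<lambda>a. G a \<one>) \<in> ring_hom R B"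
  by (rule ring_hom_memI) (simp_all add: G_mult G_add one_B)

end


section \<open>Zariski open sets and sections\<close>

definition basic_open :: "'a ring \<Rightarrow> 'a \<Rightarrow> 'a set set" where
  "basic_open R f = {P \<in> Spec R. f \<notin> P}"

lemma zariski_open_subset: "zariski_open R U \<Longrightarrow> U \<subseteq> Spec R"
  by (auto simp: zariski_open_def)

context
  fixes R :: "'a ring" (structure)
  assumes R: "cring R"
begin

interpretation cring R by (rule R)

lemma frac_cring_stalk:
  assumes "primeideal P R"
  shows "frac_cring R (carrier R - P)"
proof -
  interpret P: primeideal P R by (rule assms)
  have "\<one> \<notin> P" using P.one_imp_carrier P.I_notcarr by blast
  moreover have "a \<otimes> b \<notin> P" if "a \<in> carrier R - P" "b \<in> carrier R - P" for a b
    using that P.I_prime by blast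
  ultimately show ?thesis
    by (intro frac_cring.intro is_cring submonoid.intro) auto
qed

lemma Spec_stalk: "P \<in> Spec R \<Longrightarrow> frac_cring R (carrier R - P)"
  using frac_cring_stalk by (simp add: Spec_def)

lemma Spec_mult_iff:
  assumes "P \<in> Spec R" "a \<in> carrier R" "b \<in> carrier R"
  shows "a \<otimes> b \<in> P \<longleftrightarrow> a \<in> P \<or> b \<in> P"
proof -
  interpret P: primeideal P R using assms(1) by (simp add: Spec_def)
  show ?thesis using assms P.I_prime P.I_l_closed P.I_r_closed by blast
qed

lemma Spec_one_notin: "P \<in> Spec R \<Longrightarrow> \<one> \<notin> P"
  using frac_cring.axioms(2)[OF Spec_stalk] submonoid.one_closed by blast

lemma zariski_open_basic: "f \<in> carrier R \<Longrightarrow> zariski_open R (basic_open R f)"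
  unfolding zariski_open_def basic_open_def by (intro exI[of _ "{f}"]) auto

lemma basic_open_one: "basic_open R \<one> = Spec R"
  using Spec_one_notin by (auto simp: basic_open_def)

lemma basic_open_mult:
  "\<lbrakk>f \<in> carrier R; g \<in> carrier R\<rbrakk> \<Longrightarrow> basic_open R (f \<otimes> g) = basic_open R f \<inter> basic_open R g"
  using Spec_mult_iff by (auto simp: basic_open_def)

lemma zariski_open_basicE:
  assumes "zariski_open R U" "P \<in> U"
  obtains f where "f \<in> carrier R" "P \<in> basic_open R f" "basic_open R f \<subseteq> U"
proof -
  obtain J where J: "J \<subseteq> carrier R" "U = {P \<in> Spec R. \<not> J \<subseteq> P}"
    using assms(1) by (auto simp: zariski_open_def)
  then obtain f where "f \<in> J" "f \<notin> P" "P \<in> Spec R" using assms(2) by blast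
  then show ?thesis
    using J by (intro that[of f]) (auto simp: basic_open_def)
qed

lemma zariski_open_Int:
  assumes U: "zariski_open R U" and V: "zariski_open R V"
  shows "zariski_open R (U \<inter> V)"
proof -
  \<comment> \<open>The largest possible choice: every f whose basic open set lies in the
    intersection. It contains the products fg of elements with D(f) inside \<open>U\<close> and D(g)
    inside \<open>V\<close>, which suffice to cover.\<close>
  define J where "J = {f \<in> carrier R. basic_open R f \<subseteq> U \<inter> V}"
  have "P \<in> U \<inter> V \<longleftrightarrow> P \<in> Spec R \<and> \<not> J \<subseteq> P" for P
  proof
    assume P: "P \<in> U \<inter> V"
    obtain f where f: "f \<in> carrier R" "P \<in> basic_open R f" "basic_open R f \<subseteq> U"
      using zariski_open_basicE[OF U] P by blast
    obtain g where g: "g \<in> carrier R" "P \<in> basic_open R g" "basic_open R g \<subseteq> V"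
      using zariski_open_basicE[OF V] P by blast
    have "f \<otimes> g \<in> J" using f g basic_open_mult by (auto simp: J_def)
    moreover have "P \<in> basic_open R (f \<otimes> g)" using f g basic_open_mult by blast
    ultimately show "P \<in> Spec R \<and> \<not> J \<subseteq> P" by (auto simp: basic_open_def)
  next
    assume "P \<in> Spec R \<and> \<not> J \<subseteq> P"
    then show "P \<in> U \<inter> V" by (auto simp: J_def basic_open_def)
  qed
  then show ?thesis
    unfolding zariski_open_def by (intro exI[of _ J]) (auto simp: J_def)
qed

lemma section_basic:
  assumes a: "a \<in> carrier R" and s: "s \<in> carrier R"
  shows "(\<lambda>P\<in>basic_open R s. stalk_frac R P a s) \<in> carrier (sections R (basic_open R s))"
proof -
  have "stalk_frac R P a s \<in> carrier (stalk R P)" if "P \<in> basic_open R s" for P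
    using that a s by (auto simp: frac_ring_def basic_open_def)
  moreover have "\<exists>V b t. zariski_open R V \<and> P \<in> V \<and> V \<subseteq> basic_open R s \<and> b \<in> carrier R \<and>
      t \<in> carrier R \<and> (\<forall>Q\<in>V. t \<notin> Q \<and>
        (\<lambda>P\<in>basic_open R s. stalk_frac R P a s) Q = stalk_frac R Q b t)"
    if "P \<in> basic_open R s" for P
    using that a s zariski_open_basic[OF s]
    by (intro exI[of _ "basic_open R s"] exI[of _ a] exI[of _ s]) (simp add: basic_open_def)
  ultimately show ?thesis by (simp add: sections_def)
qed

text \<open>Used with cross products x = at and y = bs: a/s and b/t agree in the stalk at P exactly
  if this ideal is not contained in P. Agreement on a set of points thereby becomes a statement
  about one ideal.\<close>

lemma ideal_annihilator:
  assumes x: "x \<in> carrier R" and y: "y \<in> carrier R"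
  shows "ideal {u \<in> carrier R. u \<otimes> x = u \<otimes> y} R"
proof (rule idealI[OF ring_axioms])
  show "subgroup {u \<in> carrier R. u \<otimes> x = u \<otimes> y} (add_monoid R)"
  proof (rule add.subgroupI)
    fix a assume "a \<in> {u \<in> carrier R. u \<otimes> x = u \<otimes> y}"
    then show "\<ominus> a \<in> {u \<in> carrier R. u \<otimes> x = u \<otimes> y}" using x y by (simp add: l_minus)
  next
    show "{u \<in> carrier R. u \<otimes> x = u \<otimes> y} \<noteq> {}" using x y by (auto intro!: exI[of _ \<zero>])
  qed (use x y in \<open>auto simp: l_distr\<close>)
next
  fix a r assume *: "a \<in> {u \<in> carrier R. u \<otimes> x = u \<otimes> y}" "r \<in> carrier R"
  then show "r \<otimes> a \<in> {u \<in> carrier R. u \<otimes> x = u \<otimes> y}" using x y by (simp add: m_assoc)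
  then show "a \<otimes> r \<in> {u \<in> carrier R. u \<otimes> x = u \<otimes> y}" using * by (simp add: m_comm)
qed

lemma stalk_frac_eq_iff:
  assumes "P \<in> Spec R" "a \<in> carrier R" "b \<in> carrier R" "s \<in> carrier R - P" "t \<in> carrier R - P"
  shows "stalk_frac R P a s = stalk_frac R P b t
    \<longleftrightarrow> \<not> {u \<in> carrier R. u \<otimes> (a \<otimes> t) = u \<otimes> (b \<otimes> s)} \<subseteq> P"
  using frac_cring.frac_eq_iff[OF Spec_stalk[OF assms(1)] assms(2-5)]
  by (auto simp: frac_cring.frac_eq_def[OF Spec_stalk[OF assms(1)]])

text \<open>Gluing along a cover by two basic open sets, possible because D(f+g) is contained in the
  union of D(f) and D(g). The fractions are first rewritten so that their cross products agree
  exactly, then combined with coefficients that express a power of f+g by the new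
  denominators.\<close>

lemma glue_fractions:
  assumes c: "f \<in> carrier R" "g \<in> carrier R" "a \<in> carrier R" "b \<in> carrier R"
      "s \<in> carrier R" "t \<in> carrier R"
    and \<sigma>f: "\<And>P. P \<in> basic_open R f \<Longrightarrow> s \<notin> P \<and> \<sigma> P = stalk_frac R P a s"
    and \<sigma>g: "\<And>P. P \<in> basic_open R g \<Longrightarrow> t \<notin> P \<and> \<sigma> P = stalk_frac R P b t"
  shows "\<exists>c\<in>carrier R. \<exists>r\<in>carrier R. \<forall>P\<in>basic_open R (f \<oplus> g). r \<notin> P \<and> \<sigma> P = stalk_frac R P c r"
proof -
  let ?E = "{u \<in> carrier R. u \<otimes> (a \<otimes> t) = u \<otimes> (b \<otimes> s)}"
  have E: "ideal ?E R" using c by (intro ideal_annihilator) auto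
  \<comment> \<open>Outside \<open>P\<close>, the product fg would make both descriptions of
    \<open>\<sigma>\<close> valid at \<open>P\<close>; equality of the two fractions in that stalk
    yields an element of \<open>?E\<close> outside \<open>P\<close>.\<close>
  have "f \<otimes> g \<in> P" if P: "primeideal P R" "?E \<subseteq> P" for P
  proof (rule ccontr)
    assume "f \<otimes> g \<notin> P"
    moreover have PS: "P \<in> Spec R" using P by (simp add: Spec_def)
    ultimately have "P \<in> basic_open R f" "P \<in> basic_open R g"
      using c Spec_mult_iff by (auto simp: basic_open_def)
    with \<sigma>f \<sigma>g have "s \<notin> P" "t \<notin> P" "stalk_frac R P a s = stalk_frac R P b t" by metis+
    then show False using stalk_frac_eq_iff[OF PS, of a b s t] c P(2) by simp
  qed
  then obtain N :: nat where "(f \<otimes> g) [^] N \<in> ?E"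
    using nat_pow_in_ideal[OF E] c by blast
  then have N: "(f [^] N \<otimes> g [^] N) \<otimes> (a \<otimes> t) = (f [^] N \<otimes> g [^] N) \<otimes> (b \<otimes> s)"
    using c by (simp add: nat_pow_distrib)
  \<comment> \<open>Expanding by powers of f and g changes neither fraction on its own basic open
    set, but absorbs the factor in front of the relation \<open>N\<close>: now the cross products
    are equal, not merely equal after multiplication.\<close>
  define a' F b' G where "a' = a \<otimes> f [^] N" and "F = s \<otimes> f [^] N"
    and "b' = b \<otimes> g [^] N" and "G = t \<otimes> g [^] N"
  have c': "a' \<in> carrier R" "b' \<in> carrier R" "F \<in> carrier R" "G \<in> carrier R"
    using c by (simp_all add: a'_def b'_def F_def G_def)
  have cross: "a' \<otimes> G = b' \<otimes> F"
    using N c by (simp add: a'_def b'_def F_def G_def m_ac)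
  have pow: "x [^] N \<notin> P" if "P \<in> basic_open R x" "x \<in> carrier R" for x P
    using that Spec_one_notin Spec_mult_iff
    by (induction N) (auto simp: basic_open_def)
  have Fp: "F \<notin> P \<and> \<sigma> P = stalk_frac R P a' F" if P: "P \<in> basic_open R f" for P
  proof -
    have PS: "P \<in> Spec R" using P by (simp add: basic_open_def)
    have "F \<notin> P" using \<sigma>f[OF P] pow[OF P] Spec_mult_iff[OF PS] c by (simp add: F_def)
    moreover have "stalk_frac R P a s = stalk_frac R P a' F"
      using frac_cring.frac_eq_iff[OF Spec_stalk[OF PS]] frac_cring.frac_eqI[OF Spec_stalk[OF PS]]
        c c' \<open>F \<notin> P\<close> \<sigma>f[OF P] by (simp add: a'_def F_def m_ac)
    ultimately show ?thesis using \<sigma>f[OF P] by simp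
  qed
  have Gp: "G \<notin> P \<and> \<sigma> P = stalk_frac R P b' G" if P: "P \<in> basic_open R g" for P
  proof -
    have PS: "P \<in> Spec R" using P by (simp add: basic_open_def)
    have "G \<notin> P" using \<sigma>g[OF P] pow[OF P] Spec_mult_iff[OF PS] c by (simp add: G_def)
    moreover have "stalk_frac R P b t = stalk_frac R P b' G"
      using frac_cring.frac_eq_iff[OF Spec_stalk[OF PS]] frac_cring.frac_eqI[OF Spec_stalk[OF PS]]
        c c' \<open>G \<notin> P\<close> \<sigma>g[OF P] by (simp add: b'_def G_def m_ac)
    ultimately show ?thesis using \<sigma>g[OF P] by simp
  qed
  define I where "I = set_add R (PIdl F) (PIdl G)"
  have id: "ideal I R" using c' unfolding I_def by (intro add_ideals cgenideal_ideal)
  have mem_I: "x \<in> I \<longleftrightarrow> (\<exists>p\<in>carrier R. \<exists>q\<in>carrier R. x = p \<otimes> F \<oplus> q \<otimes> G)" for x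
    unfolding I_def set_add_defs cgenideal_def by auto
  have sub: "F \<in> I" "G \<in> I"
  proof -
    show "F \<in> I" unfolding mem_I by (rule bexI[of _ \<one>], rule bexI[of _ \<zero>]) (use c' in simp_all)
    show "G \<in> I" unfolding mem_I by (rule bexI[of _ \<zero>], rule bexI[of _ \<one>]) (use c' in simp_all)
  qed
  \<comment> \<open>\<open>F\<close> is invertible at every point of D(f) and \<open>G\<close> at
    every point of D(g). A prime containing both therefore contains f and g.\<close>
  have "f \<oplus> g \<in> P" if P: "primeideal P R" "I \<subseteq> P" for P
  proof -
    interpret P: primeideal P R by (rule P(1))
    have "P \<in> Spec R" using P by (simp add: Spec_def)
    then have "f \<in> P" "g \<in> P" using Fp[of P] Gp[of P] sub P(2) by (auto simp: basic_open_def)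
    then show ?thesis by simp
  qed
  then obtain M :: nat where "(f \<oplus> g) [^] M \<in> I"
    using nat_pow_in_ideal[OF id] c by blast
  then obtain p q where pq: "p \<in> carrier R" "q \<in> carrier R"
    and M: "(f \<oplus> g) [^] M = p \<otimes> F \<oplus> q \<otimes> G"
    unfolding mem_I by auto
  \<comment> \<open>The numerator uses the same coefficients \<open>p\<close>, \<open>q\<close> as
    the denominator, so \<open>cross\<close> gives e/r = a'/F and e/r = b'/G simultaneously. By
    \<open>M\<close>, \<open>r\<close> is a power of f+g and hence invertible on D(f+g).\<close>
  define e r where "e = p \<otimes> a' \<oplus> q \<otimes> b'" and "r = p \<otimes> F \<oplus> q \<otimes> G"
  have er: "e \<in> carrier R" "r \<in> carrier R" using pq c' by (simp_all add: e_def r_def)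
  have "a' \<otimes> r = p \<otimes> (a' \<otimes> F) \<oplus> q \<otimes> (a' \<otimes> G)"
    unfolding r_def using pq c' by (simp add: r_distr m_ac)
  also have "\<dots> = e \<otimes> F" unfolding cross e_def using pq c' by (simp add: l_distr r_distr m_ac)
  finally have aF: "a' \<otimes> r = e \<otimes> F" .
  have "b' \<otimes> r = p \<otimes> (b' \<otimes> F) \<oplus> q \<otimes> (b' \<otimes> G)"
    unfolding r_def using pq c' by (simp add: r_distr m_ac)
  also have "\<dots> = e \<otimes> G" unfolding cross[symmetric] e_def using pq c' by (simp add: l_distr r_distr m_ac)
  finally have bG: "b' \<otimes> r = e \<otimes> G" .
  have "r \<notin> P \<and> \<sigma> P = stalk_frac R P e r" if P: "P \<in> basic_open R (f \<oplus> g)" for P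
  proof -
    have PS: "P \<in> Spec R" using P by (simp add: basic_open_def)
    interpret P: primeideal P R using PS by (simp add: Spec_def)
    have "(f \<oplus> g) [^] M \<notin> P" 
      using P c Spec_one_notin Spec_mult_iff
      by (induction M) (auto simp: basic_open_def)
    then have r: "r \<notin> P" using M by (simp add: r_def)
    have "P \<in> basic_open R f \<or> P \<in> basic_open R g"
      using P PS P.a_closed by (auto simp: basic_open_def)
    then show ?thesis
    proof
      assume "P \<in> basic_open R f"
      from Fp[OF this] show ?thesis
        using aF r er c' frac_cring.frac_eq_iff[OF Spec_stalk[OF PS], of a' e F r]
          frac_cring.frac_eqI[OF Spec_stalk[OF PS]] by simp
    next
      assume "P \<in> basic_open R g"
      from Gp[OF this] show ?thesis
        using bG r er c' frac_cring.frac_eq_iff[OF Spec_stalk[OF PS], of b' e G r]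
          frac_cring.frac_eqI[OF Spec_stalk[OF PS]] by simp
    qed
  qed
  then show ?thesis using er by blast
qed

text \<open>That these \<open>f\<close> form an ideal reduces the gluing of a section to the gluing of two fractions;
  no finite subcover is needed.\<close>

lemma ideal_representable:
  fixes \<sigma> :: "'a regular_fun"
  shows "ideal {f \<in> carrier R. \<exists>a\<in>carrier R. \<exists>s\<in>carrier R.
    \<forall>P\<in>basic_open R f. P \<in> U \<and> s \<notin> P \<and> \<sigma> P = stalk_frac R P a s} R" (is "ideal ?E R")
proof (rule idealI[OF ring_axioms])
  have mult: "r \<otimes> f \<in> ?E" if f: "f \<in> ?E" and r: "r \<in> carrier R" for f r
  proof -
    have "basic_open R (r \<otimes> f) \<subseteq> basic_open R f" using f r basic_open_mult by auto
    then show ?thesis using f r by blast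
  qed
  show "subgroup ?E (add_monoid R)"
  proof (rule add.subgroupI)
    have "basic_open R \<zero> = {}"
      by (auto simp: basic_open_def Spec_def primeideal_def ideal_def additive_subgroup.zero_closed)
    then show "?E \<noteq> {}" by auto
  next
    fix f assume f: "f \<in> ?E"
    then have "\<ominus> f = \<ominus> \<one> \<otimes> f" by (simp add: l_minus)
    then show "\<ominus> f \<in> ?E" using mult[OF f, of "\<ominus> \<one>"] by simp
  next
    fix f g assume f: "f \<in> ?E" and g: "g \<in> ?E"
    then obtain a s b t where c: "f \<in> carrier R" "g \<in> carrier R" "a \<in> carrier R" "b \<in> carrier R"
      "s \<in> carrier R" "t \<in> carrier R"
      and fs: "\<And>P. P \<in> basic_open R f \<Longrightarrow> P \<in> U \<and> s \<notin> P \<and> \<sigma> P = stalk_frac R P a s"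
      and gt: "\<And>P. P \<in> basic_open R g \<Longrightarrow> P \<in> U \<and> t \<notin> P \<and> \<sigma> P = stalk_frac R P b t"
      by auto
    have "basic_open R (f \<oplus> g) \<subseteq> basic_open R f \<union> basic_open R g"
      using c by (auto simp: basic_open_def Spec_def primeideal_def ideal_def
          additive_subgroup.a_closed)
    then have U: "P \<in> U" if "P \<in> basic_open R (f \<oplus> g)" for P
      using that fs gt by blast
    have "\<exists>e\<in>carrier R. \<exists>r\<in>carrier R. \<forall>P\<in>basic_open R (f \<oplus> g).
        r \<notin> P \<and> \<sigma> P = stalk_frac R P e r"
      by (rule glue_fractions[OF c]) (simp_all add: fs gt)
    then have "\<exists>e\<in>carrier R. \<exists>r\<in>carrier R. \<forall>P\<in>basic_open R (f \<oplus> g).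
        P \<in> U \<and> r \<notin> P \<and> \<sigma> P = stalk_frac R P e r"
      using U by simp
    then show "f \<oplus> g \<in> ?E" using c by simp
  qed auto
  show "r \<otimes> f \<in> ?E" if "f \<in> ?E" "r \<in> carrier R" for f r
    using mult that .
  show "f \<otimes> r \<in> ?E" if "f \<in> ?E" "r \<in> carrier R" for f r
    using mult[OF that] that m_comm[of f r] by simp
qed

end


section \<open>Sections near the closed subset of a surjection\<close>

locale surj_ring_hom = ring_hom_cring R T h
  for R :: "'a ring" (structure) and T :: "'b ring" (structure) and h +
  assumes surj: "h ` carrier R = carrier T"
begin

abbreviation Z :: "'a set set" where
  "Z \<equiv> Spec_map R h ` Spec T"

text \<open>Elements sent to 1 rather than to units: by surjectivity an element with unit image has
  a multiple in \<open>M\<close>, so the localisation is the same, while s - 1 lies in the kernel of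
  \<open>h\<close> for every s in \<open>M\<close>.\<close>

definition M :: "'a set" where
  "M = {s \<in> carrier R. h s = \<one>\<^bsub>T\<^esub>}"

lemma M_hom: "s \<in> M \<Longrightarrow> h s = \<one>\<^bsub>T\<^esub>"
  by (simp add: M_def)

lemma M_memI: "\<lbrakk>s \<in> carrier R; h s = \<one>\<^bsub>T\<^esub>\<rbrakk> \<Longrightarrow> s \<in> M"
  by (simp add: M_def)

sublocale frac_cring R M
proof (intro frac_cring.intro R.is_cring submonoid.intro)
  show "M \<subseteq> carrier R" by (auto simp: M_def)
qed (auto simp: M_def)

text \<open>Surjectivity makes \<open>Z\<close> the closed set of the kernel. For a prime
  \<open>P\<close> above the kernel, the image of \<open>P\<close> is an ideal because
  \<open>h\<close> is onto, and \<open>P\<close> is the full preimage of that image because elements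
  with the same image differ by an element of the kernel; primality follows from the latter.\<close>

lemma Z_eq: "Z = {P \<in> Spec R. \<forall>x\<in>carrier R. h x = \<zero>\<^bsub>T\<^esub> \<longrightarrow> x \<in> P}"
proof (intro equalityI subsetI)
  fix P assume "P \<in> Z"
  then obtain Q where Q: "primeideal Q T" "P = {x \<in> carrier R. h x \<in> Q}"
    by (auto simp: Spec_def Spec_map_def)
  interpret Q: primeideal Q T by (rule Q(1))
  have "primeideal P R" using ring.primeideal_vimage[OF R.is_cring Q(1)] Q(2) by simp
  then show "P \<in> {P \<in> Spec R. \<forall>x\<in>carrier R. h x = \<zero>\<^bsub>T\<^esub> \<longrightarrow> x \<in> P}"
    using Q(2) by (simp add: Spec_def)
next
  fix P assume "P \<in> {P \<in> Spec R. \<forall>x\<in>carrier R. h x = \<zero>\<^bsub>T\<^esub> \<longrightarrow> x \<in> P}"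
  then have P: "primeideal P R" and ker: "\<And>x. \<lbrakk>x \<in> carrier R; h x = \<zero>\<^bsub>T\<^esub>\<rbrakk> \<Longrightarrow> x \<in> P"
    by (auto simp: Spec_def)
  interpret P: primeideal P R by (rule P)
  have mem: "x \<in> P" if x: "x \<in> carrier R" and hx: "h x \<in> h ` P" for x
  proof -
    obtain y where y: "y \<in> P" "h x = h y" using hx by blast
    then have "x \<ominus> y \<in> P" using x by (intro ker) (auto simp: R.minus_eq S.r_neg)
    then have "x \<ominus> y \<oplus> y \<in> P" using y by simp
    moreover have "x \<ominus> y \<oplus> y = x" using x y by (simp add: R.minus_eq R.a_assoc R.l_neg)
    ultimately show ?thesis by simp
  qed
  have "primeideal (h ` P) T"
  proof (rule primeidealI[OF _ S.is_cring])
    show "ideal (h ` P) T"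
    proof (rule idealI[OF S.ring_axioms])
      show "subgroup (h ` P) (add_monoid T)"
      proof (rule S.add.subgroupI)
        show "h ` P \<noteq> {}" using P.zero_closed by blast
        fix a b assume "a \<in> h ` P" "b \<in> h ` P"
        then obtain x y where xy: "x \<in> P" "y \<in> P" "a = h x" "b = h y" by blast
        show "a \<oplus>\<^bsub>T\<^esub> b \<in> h ` P"
          using xy by (intro image_eqI[of _ _ "x \<oplus> y"]) auto
        show "\<ominus>\<^bsub>T\<^esub> a \<in> h ` P"
          using xy by (intro image_eqI[of _ _ "\<ominus> x"]) auto
      qed auto
    next
      fix a r assume "a \<in> h ` P" "r \<in> carrier T"
      then obtain x y where xy: "x \<in> P" "y \<in> carrier R" "a = h x" "r = h y"
        using surj by blast
      show "r \<otimes>\<^bsub>T\<^esub> a \<in> h ` P"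
        using xy P.I_l_closed by (intro image_eqI[of _ _ "y \<otimes> x"]) auto
      show "a \<otimes>\<^bsub>T\<^esub> r \<in> h ` P"
        using xy P.I_r_closed by (intro image_eqI[of _ _ "x \<otimes> y"]) auto
    qed
    show "carrier T \<noteq> h ` P"
    proof
      assume "carrier T = h ` P"
      then have "\<one> \<in> P" using mem[of \<one>] S.one_closed by auto
      then show False using P.one_imp_carrier P.I_notcarr by blast
    qed
    fix a b assume ab: "a \<in> carrier T" "b \<in> carrier T" "a \<otimes>\<^bsub>T\<^esub> b \<in> h ` P"
    then obtain x y where xy: "x \<in> carrier R" "y \<in> carrier R" "a = h x" "b = h y"
      using surj by blast
    then have "x \<otimes> y \<in> P" using ab by (intro mem) auto
    then have "x \<in> P \<or> y \<in> P" using xy P.I_prime by blast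
    then show "a \<in> h ` P \<or> b \<in> h ` P" using xy by blast
  qed
  moreover have "P = Spec_map R h (h ` P)"
    using mem P.Icarr by (auto simp: Spec_map_def)
  ultimately show "P \<in> Z" by (auto simp: Spec_def)
qed

text \<open>Every point of \<open>Z\<close> contains 1 - s, so it cannot contain s as well.\<close>

lemma Z_subset_basic_open: "s \<in> M \<Longrightarrow> Z \<subseteq> basic_open R s"
proof
  fix P assume s: "s \<in> M" and "P \<in> Z"
  then have P: "primeideal P R" and ker: "\<And>x. \<lbrakk>x \<in> carrier R; h x = \<zero>\<^bsub>T\<^esub>\<rbrakk> \<Longrightarrow> x \<in> P"
    unfolding Z_eq by (auto simp: Spec_def)
  interpret P: primeideal P R by (rule P)
  have "s \<notin> P"
  proof
    assume sP: "s \<in> P"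
    have sc: "s \<in> carrier R" and hs: "h s = \<one>\<^bsub>T\<^esub>" using s M_hom by auto
    have "h (\<one> \<ominus> s) = \<zero>\<^bsub>T\<^esub>" using sc by (simp add: R.minus_eq hs S.r_neg)
    then have "\<one> \<ominus> s \<in> P" using sc by (intro ker) simp_all
    then have "\<one> \<ominus> s \<oplus> s \<in> P" using sP by simp
    moreover have "\<one> \<ominus> s \<oplus> s = \<one>" using sc by (simp add: R.minus_eq R.a_assoc R.l_neg)
    ultimately show False using P.one_imp_carrier P.I_notcarr by simp
  qed
  then show "P \<in> basic_open R s" using P by (simp add: basic_open_def Spec_def)
qed

lemma Z_subset_Spec: "Z \<subseteq> Spec R"
  unfolding Z_eq by blast

text \<open>A prime above both \<open>E\<close> and the kernel would be a point of \<open>Z\<close>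
  containing \<open>E\<close>. Hence the sum of the two ideals is the whole ring, and in 1 = e + k
  with k in the kernel the summand e maps to 1. This replaces compactness arguments near
  \<open>Z\<close>.\<close>

lemma ideal_meets_M:
  assumes E: "ideal E R" and out: "\<And>P. P \<in> Z \<Longrightarrow> \<not> E \<subseteq> P"
  shows "\<exists>s\<in>E. s \<in> M"
proof -
  define I where "I = set_add R E (a_kernel R T h)"
  have id: "ideal I R"
    unfolding I_def by (intro R.add_ideals E ring.kernel_is_ideal)
  have mem_I: "x \<in> I \<longleftrightarrow> (\<exists>e\<in>E. \<exists>k\<in>carrier R. h k = \<zero>\<^bsub>T\<^esub> \<and> x = e \<oplus> k)" for x
    unfolding I_def set_add_defs a_kernel_def' by auto
  interpret E: ideal E R by (rule E)
  have "\<one> \<in> P" if P: "primeideal P R" "I \<subseteq> P" for P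
  proof -
    have "E \<subseteq> I"
    proof
      fix e assume e: "e \<in> E"
      show "e \<in> I" unfolding mem_I by (rule bexI[OF _ e], rule bexI[of _ \<zero>]) (use e in simp_all)
    qed
    moreover have "x \<in> I" if "x \<in> carrier R" "h x = \<zero>\<^bsub>T\<^esub>" for x
      unfolding mem_I by (rule bexI[of _ \<zero>], rule bexI[of _ x]) (use that in simp_all)
    ultimately have "P \<in> Z" "E \<subseteq> P" using P unfolding Z_eq by (auto simp: Spec_def)
    then show ?thesis using out by blast
  qed
  then obtain k :: nat where "\<one> [^] k \<in> I"
    using R.nat_pow_in_ideal[OF id] by blast
  then obtain e k where e: "e \<in> E" "k \<in> carrier R" "h k = \<zero>\<^bsub>T\<^esub>" "\<one> = e \<oplus> k"
    by (auto simp: mem_I)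
  then have "h \<one> = h e \<oplus>\<^bsub>T\<^esub> h k" using E.Icarr by (metis hom_add)
  then have "h e = \<one>\<^bsub>T\<^esub>" using hom_closed[OF E.Icarr[OF e(1)]] by (simp add: e(3))
  then show ?thesis using e(1) E.Icarr[OF e(1)] M_memI by blast
qed

text \<open>The f for which \<open>\<sigma>\<close> is a single fraction on D(f) form an ideal by
  \<open>ideal_representable\<close>. The local description of \<open>\<sigma>\<close> at a point of
  \<open>Z\<close> gives such an f outside that point, so the ideal meets \<open>M\<close>; the D(f)
  of a common element is the neighbourhood \<open>W\<close>.\<close>

lemma section_near_Z:
  assumes U: "zariski_open R U" and ZU: "Z \<subseteq> U" and \<sigma>: "\<sigma> \<in> carrier (sections R U)"
  shows "\<exists>a\<in>carrier R. \<exists>s\<in>M. \<exists>W. zariski_open R W \<and> Z \<subseteq> W \<and> W \<subseteq> U \<and>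
    (\<forall>P\<in>W. s \<notin> P \<and> \<sigma> P = stalk_frac R P a s)"
proof -
  let ?E = "{f \<in> carrier R. \<exists>a\<in>carrier R. \<exists>s\<in>carrier R.
    \<forall>P\<in>basic_open R f. P \<in> U \<and> s \<notin> P \<and> \<sigma> P = stalk_frac R P a s}"
  have "\<not> ?E \<subseteq> P" if "P \<in> Z" for P
  proof -
    have "P \<in> U" using that ZU by blast
    then obtain V a s where V: "zariski_open R V" "P \<in> V" "V \<subseteq> U" and as: "a \<in> carrier R" "s \<in> carrier R"
      and eq: "\<forall>Q\<in>V. s \<notin> Q \<and> \<sigma> Q = stalk_frac R Q a s"
      using \<sigma> unfolding sections_def by force
    obtain f where f: "f \<in> carrier R" "P \<in> basic_open R f" "basic_open R f \<subseteq> V"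
      using zariski_open_basicE[OF R.is_cring V(1,2)] .
    have "f \<in> ?E" using f V(3) as eq by blast
    then show ?thesis using f(2) by (auto simp: basic_open_def)
  qed
  then obtain f where "f \<in> ?E" and fM: "f \<in> M"
    using ideal_meets_M[OF ideal_representable[OF R.is_cring, of U \<sigma>]] by blast
  then obtain a s where f: "f \<in> carrier R" and as: "a \<in> carrier R" "s \<in> carrier R"
    and eq: "\<forall>P\<in>basic_open R f. P \<in> U \<and> s \<notin> P \<and> \<sigma> P = stalk_frac R P a s" by blast
  \<comment> \<open>The denominator \<open>s\<close> found so far need not lie in \<open>M\<close>.
    It vanishes nowhere on D(f), so a power of f is a multiple rs, and a/s can be rewritten as ra
    over that power, which does lie in \<open>M\<close>.\<close>
  have "f \<in> P" if P: "primeideal P R" "PIdl s \<subseteq> P" for P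
    using eq P R.cgenideal_self[OF as(2)] by (auto simp: basic_open_def Spec_def)
  then obtain k :: nat where "f [^] k \<in> PIdl s"
    using R.nat_pow_in_ideal[OF R.cgenideal_ideal[OF as(2)] f] by blast
  then obtain r where r: "r \<in> carrier R" "f [^] k = r \<otimes> s"
    by (auto simp: cgenideal_def)
  have "h (f [^] k) = \<one>\<^bsub>T\<^esub>" using M_hom[OF fM] f by (induction k) auto
  then have fk: "f [^] k \<in> M" using f by (intro M_memI) simp_all
  have "f [^] k \<notin> P \<and> \<sigma> P = stalk_frac R P (r \<otimes> a) (f [^] k)" if P: "P \<in> basic_open R f" for P
  proof -
    have PS: "P \<in> Spec R" using P by (simp add: basic_open_def)
    have notin: "f [^] k \<notin> P"
      using P f Spec_one_notin[OF R.is_cring] Spec_mult_iff[OF R.is_cring]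
      by (induction k) (auto simp: basic_open_def)
    have "stalk_frac R P a s = stalk_frac R P (r \<otimes> a) (f [^] k)"
      using eq P as f r notin
        frac_cring.frac_eq_iff[OF Spec_stalk[OF R.is_cring PS], of a "r \<otimes> a" s "f [^] k"]
        frac_cring.frac_eqI[OF Spec_stalk[OF R.is_cring PS], of a "f [^] k" "r \<otimes> a" s]
      by (simp add: R.m_ac)
    then show ?thesis using notin eq P by simp
  qed
  moreover have "basic_open R f \<subseteq> U" using eq by blast
  moreover note zariski_open_basic[OF R.is_cring f] Z_subset_basic_open[OF fM] fk
  moreover have "r \<otimes> a \<in> carrier R" using r as by simp
  ultimately show ?thesis by meson
qed

end


section \<open>Germs as fractions\<close>

text \<open>A witness \<open>u\<close> in \<open>S\<close> for the equality of two fractions is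
  carried to a witness in \<open>S'\<close>, so the image class does not depend on the
  representative.\<close>

lemma (in frac_cring) Union_frac_map:
  assumes R': "frac_cring R' S'" and \<theta>: "\<theta> \<in> ring_hom R R'" and \<theta>S: "\<And>x. x \<in> S \<Longrightarrow> \<theta> x \<in> S'"
    and a: "a \<in> carrier R" and s: "s \<in> S"
  shows "(\<Union>(b, t)\<in>frac R S a s. frac R' S' (\<theta> b) (\<theta> t)) = frac R' S' (\<theta> a) (\<theta> s)"
proof (rule UN_pair_const[OF frac_self[OF a s]])
  interpret R': frac_cring R' S' by (rule R')
  fix b t assume "(b, t) \<in> frac R S a s"
  then have bt: "b \<in> carrier R" "t \<in> S" and "frac_eq a s b t"
    using mem_frac_iff[OF a s] by auto
  then obtain u where u: "u \<in> S" "u \<otimes> (a \<otimes> t) = u \<otimes> (b \<otimes> s)"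
    by (auto simp: frac_eq_def)
  then have "\<theta> (u \<otimes> (a \<otimes> t)) = \<theta> (u \<otimes> (b \<otimes> s))" by simp
  then have "\<theta> u \<otimes>\<^bsub>R'\<^esub> (\<theta> b \<otimes>\<^bsub>R'\<^esub> \<theta> s) = \<theta> u \<otimes>\<^bsub>R'\<^esub> (\<theta> a \<otimes>\<^bsub>R'\<^esub> \<theta> t)"
    using a bt u(1) s by (simp add: ring_hom_mult[OF \<theta>])
  then have "R'.frac_eq (\<theta> b) (\<theta> t) (\<theta> a) (\<theta> s)"
    unfolding R'.frac_eq_def using \<theta>S[OF u(1)] by blast
  then show "frac R' S' (\<theta> b) (\<theta> t) = frac R' S' (\<theta> a) (\<theta> s)"
    using R'.frac_eq_iff a bt s \<theta>S ring_hom_closed[OF \<theta>] by simp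
qed

definition loc_frac :: "'a ring \<Rightarrow> 'b ring \<Rightarrow> ('a \<Rightarrow> 'b) \<Rightarrow> 'a \<Rightarrow> 'a \<Rightarrow> 'a loc_elem" where
  "loc_frac R T h a s = germ R (Spec_map R h ` Spec T) (basic_open R s)
     (\<lambda>P\<in>basic_open R s. stalk_frac R P a s)"

lemma germ_subset:
  assumes "cring R" and W: "zariski_open R W" "Z \<subseteq> W" "W \<subseteq> U \<inter> U'"
    and eq: "\<And>P. P \<in> W \<Longrightarrow> \<sigma> P = \<sigma>' P"
  shows "germ R Z U \<sigma> \<subseteq> germ R Z U' \<sigma>'"
proof
  fix p assume "p \<in> germ R Z U \<sigma>"
  then obtain V \<tau> W' where p: "p = (V, \<tau>)" "zariski_open R V" "Z \<subseteq> V" "\<tau> \<in> carrier (sections R V)"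
    and W': "zariski_open R W'" "Z \<subseteq> W'" "W' \<subseteq> U \<inter> V" "restrict \<sigma> W' = restrict \<tau> W'"
    by (auto simp: germ_def)
  have "restrict \<sigma>' (W \<inter> W') P = restrict \<tau> (W \<inter> W') P" for P
    using eq[of P] fun_cong[OF W'(4), of P] by (simp add: restrict_def split: if_splits)
  then have "restrict \<sigma>' (W \<inter> W') = restrict \<tau> (W \<inter> W')" ..
  moreover have "zariski_open R (W \<inter> W')" using zariski_open_Int[OF assms(1)] W W' by blast
  ultimately show "p \<in> germ R Z U' \<sigma>'"
    using p W W' unfolding germ_def by blast
qed

lemma germ_cong:
  assumes "cring R" and W: "zariski_open R W" "Z \<subseteq> W" "W \<subseteq> U \<inter> U'"
    and eq: "\<And>P. P \<in> W \<Longrightarrow> \<sigma> P = \<sigma>' P"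
  shows "germ R Z U \<sigma> = germ R Z U' \<sigma>'"
proof
  show "germ R Z U \<sigma> \<subseteq> germ R Z U' \<sigma>'"
    by (rule germ_subset[OF assms])
  show "germ R Z U' \<sigma>' \<subseteq> germ R Z U \<sigma>"
    by (rule germ_subset[OF assms(1) W(1,2)]) (use W(3) eq in auto)
qed

context surj_ring_hom
begin

lemma loc_frac_memE:
  assumes "(U, \<sigma>) \<in> loc_frac R T h a s"
  obtains W where "zariski_open R W" "Z \<subseteq> W" "W \<subseteq> U"
    "\<And>P. P \<in> W \<Longrightarrow> s \<notin> P \<and> \<sigma> P = stalk_frac R P a s"
proof -
  obtain W where W: "zariski_open R W" "Z \<subseteq> W" "W \<subseteq> basic_open R s \<inter> U"
    and eq: "restrict (\<lambda>P\<in>basic_open R s. stalk_frac R P a s) W = restrict \<sigma> W"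
    using assms by (auto simp: loc_frac_def germ_def)
  show ?thesis
  proof (rule that[OF W(1,2)])
    show "W \<subseteq> U" using W by blast
    fix P assume P: "P \<in> W"
    then show "s \<notin> P \<and> \<sigma> P = stalk_frac R P a s"
      using W(3) fun_cong[OF eq, of P] by (auto simp: basic_open_def)
  qed
qed

text \<open>Counterpart of \<open>loc_frac_memE\<close>. Through these two, identities of germs are
  checked pointwise: to be the germ of a/s means to agree with a/s in the stalks over one open
  neighbourhood of \<open>Z\<close>.\<close>

lemma loc_frac_eq_germ:
  assumes "zariski_open R W" "Z \<subseteq> W" "W \<subseteq> U"
    and eq: "\<And>P. P \<in> W \<Longrightarrow> s \<notin> P \<and> \<sigma> P = stalk_frac R P a s"
  shows "germ R Z U \<sigma> = loc_frac R T h a s"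
proof -
  have "W \<subseteq> basic_open R s"
    using zariski_open_subset[OF assms(1)] eq by (auto simp: basic_open_def)
  then show ?thesis
    unfolding loc_frac_def using assms by (intro germ_cong[OF R.is_cring assms(1,2)]) auto
qed

lemma loc_frac_self:
  assumes "a \<in> carrier R" "s \<in> M"
  shows "(basic_open R s, \<lambda>P\<in>basic_open R s. stalk_frac R P a s) \<in> loc_frac R T h a s"
  unfolding loc_frac_def germ_def
  using assms zariski_open_basic[OF R.is_cring] section_basic[OF R.is_cring] Z_subset_basic_open[of s]
  by blast

text \<open>A witness u in \<open>M\<close> makes the fractions agree on D(ust), a neighbourhood of
  \<open>Z\<close> because ust is again in \<open>M\<close>. Conversely, agreement near
  \<open>Z\<close> says that the ideal of witnesses lies in no point of \<open>Z\<close>, so it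
  contains one from \<open>M\<close>.\<close>

lemma loc_frac_eq_iff:
  assumes "a \<in> carrier R" "b \<in> carrier R" "s \<in> M" "t \<in> M"
  shows "loc_frac R T h a s = loc_frac R T h b t \<longleftrightarrow> frac_eq a s b t"
proof
  assume "frac_eq a s b t"
  then obtain u where u: "u \<in> M" "u \<otimes> (a \<otimes> t) = u \<otimes> (b \<otimes> s)" by (auto simp: frac_eq_def)
  let ?W = "basic_open R (u \<otimes> (s \<otimes> t))"
  have W: "?W = basic_open R u \<inter> (basic_open R s \<inter> basic_open R t)"
    using assms u by (simp add: basic_open_mult[OF R.is_cring])
  show "loc_frac R T h a s = loc_frac R T h b t"
    unfolding loc_frac_def[of R T h a s]
  proof (rule loc_frac_eq_germ)
    show "zariski_open R ?W" using assms u by (intro zariski_open_basic[OF R.is_cring]) auto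
    show "Z \<subseteq> ?W" using assms u by (intro Z_subset_basic_open) auto
    show "?W \<subseteq> basic_open R s" using W by blast
    fix P assume "P \<in> ?W"
    then have P: "P \<in> Spec R" "u \<notin> P" "s \<notin> P" "t \<notin> P" unfolding W by (auto simp: basic_open_def)
    then have "stalk_frac R P a s = stalk_frac R P b t"
      using stalk_frac_eq_iff[OF R.is_cring P(1), of a b s t] assms u by auto
    then show "t \<notin> P \<and> (\<lambda>P\<in>basic_open R s. stalk_frac R P a s) P = stalk_frac R P b t"
      using P by (simp add: basic_open_def)
  qed
next
  assume "loc_frac R T h a s = loc_frac R T h b t"
  then have "(basic_open R t, \<lambda>P\<in>basic_open R t. stalk_frac R P b t) \<in> loc_frac R T h a s"
    using loc_frac_self assms by simp
  then obtain W where W: "zariski_open R W" "Z \<subseteq> W" "W \<subseteq> basic_open R t"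
    and eq: "\<And>P. P \<in> W \<Longrightarrow> s \<notin> P \<and> (\<lambda>P\<in>basic_open R t. stalk_frac R P b t) P = stalk_frac R P a s"
    by (rule loc_frac_memE) blast
  let ?E = "{u \<in> carrier R. u \<otimes> (a \<otimes> t) = u \<otimes> (b \<otimes> s)}"
  have "\<not> ?E \<subseteq> P" if "P \<in> Z" for P
  proof -
    have PW: "P \<in> W" using that W by blast
    then have "P \<in> Spec R" "t \<notin> P" using W(3) by (auto simp: basic_open_def)
    moreover from this have "stalk_frac R P a s = stalk_frac R P b t" "s \<notin> P"
      using eq[OF PW] by (auto simp: basic_open_def)
    ultimately show ?thesis
      using stalk_frac_eq_iff[OF R.is_cring, of P a b s t] assms by auto
  qed
  then obtain u where "u \<in> ?E" "u \<in> M"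
    using ideal_meets_M[OF ideal_annihilator[OF R.is_cring], of "a \<otimes> t" "b \<otimes> s"] assms by auto
  then show "frac_eq a s b t" by (auto simp: frac_eq_def)
qed

lemma stalk_mult:
  assumes "P \<in> Spec R" "a \<in> carrier R" "b \<in> carrier R" "s \<in> carrier R - P" "t \<in> carrier R - P"
  shows "stalk_frac R P a s \<otimes>\<^bsub>stalk R P\<^esub> stalk_frac R P b t = stalk_frac R P (a \<otimes> b) (s \<otimes> t)"
  using frac_cring.frac_ring_mult[OF Spec_stalk[OF R.is_cring assms(1)] assms(2-5)] .

lemma stalk_add:
  assumes "P \<in> Spec R" "a \<in> carrier R" "b \<in> carrier R" "s \<in> carrier R - P" "t \<in> carrier R - P"
  shows "stalk_frac R P a s \<oplus>\<^bsub>stalk R P\<^esub> stalk_frac R P b t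
    = stalk_frac R P (a \<otimes> t \<oplus> b \<otimes> s) (s \<otimes> t)"
  using frac_cring.frac_ring_add[OF Spec_stalk[OF R.is_cring assms(1)] assms(2-5)] .

lemma loc_frac_mult:
  assumes ab: "a \<in> carrier R" "b \<in> carrier R" "s \<in> M" "t \<in> M"
  shows "loc_frac R T h a s \<otimes>\<^bsub>germs R Z\<^esub> loc_frac R T h b t = loc_frac R T h (a \<otimes> b) (s \<otimes> t)"
  unfolding germs_def monoid.simps ring.simps
proof (rule UN_pair2_const[OF loc_frac_self[OF ab(1,3)] loc_frac_self[OF ab(2,4)]])
  fix U \<sigma> V \<tau> assume U: "(U, \<sigma>) \<in> loc_frac R T h a s" and V: "(V, \<tau>) \<in> loc_frac R T h b t"
  obtain W where W: "zariski_open R W" "Z \<subseteq> W" "W \<subseteq> U"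
    "\<And>P. P \<in> W \<Longrightarrow> s \<notin> P \<and> \<sigma> P = stalk_frac R P a s"
    using loc_frac_memE[OF U] by blast
  obtain W' where W': "zariski_open R W'" "Z \<subseteq> W'" "W' \<subseteq> V"
    "\<And>P. P \<in> W' \<Longrightarrow> t \<notin> P \<and> \<tau> P = stalk_frac R P b t"
    using loc_frac_memE[OF V] by blast
  show "germ R Z (U \<inter> V) (restrict \<sigma> (U \<inter> V) \<otimes>\<^bsub>sections R (U \<inter> V)\<^esub> restrict \<tau> (U \<inter> V))
      = loc_frac R T h (a \<otimes> b) (s \<otimes> t)"
  proof (rule loc_frac_eq_germ)
    show "zariski_open R (W \<inter> W')" by (rule zariski_open_Int[OF R.is_cring W(1) W'(1)])
    show "Z \<subseteq> W \<inter> W'" "W \<inter> W' \<subseteq> U \<inter> V" using W W' by auto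
    fix P assume P: "P \<in> W \<inter> W'"
    then have PS: "P \<in> Spec R" using zariski_open_subset[OF W(1)] by blast
    have "s \<notin> P" "t \<notin> P" "\<sigma> P = stalk_frac R P a s" "\<tau> P = stalk_frac R P b t" "P \<in> U" "P \<in> V"
      using P W(3) W'(3) W(4)[of P] W'(4)[of P] by auto
    then show "s \<otimes> t \<notin> P \<and> (restrict \<sigma> (U \<inter> V) \<otimes>\<^bsub>sections R (U \<inter> V)\<^esub> restrict \<tau> (U \<inter> V)) P
        = stalk_frac R P (a \<otimes> b) (s \<otimes> t)"
      using ab Spec_mult_iff[OF R.is_cring PS] stalk_mult[OF PS] by (simp add: sections_def)
  qed
qed

lemma loc_frac_add:
  assumes ab: "a \<in> carrier R" "b \<in> carrier R" "s \<in> M" "t \<in> M"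
  shows "loc_frac R T h a s \<oplus>\<^bsub>germs R Z\<^esub> loc_frac R T h b t
    = loc_frac R T h (a \<otimes> t \<oplus> b \<otimes> s) (s \<otimes> t)"
  unfolding germs_def monoid.simps ring.simps
proof (rule UN_pair2_const[OF loc_frac_self[OF ab(1,3)] loc_frac_self[OF ab(2,4)]])
  fix U \<sigma> V \<tau> assume U: "(U, \<sigma>) \<in> loc_frac R T h a s" and V: "(V, \<tau>) \<in> loc_frac R T h b t"
  obtain W where W: "zariski_open R W" "Z \<subseteq> W" "W \<subseteq> U"
    "\<And>P. P \<in> W \<Longrightarrow> s \<notin> P \<and> \<sigma> P = stalk_frac R P a s"
    using loc_frac_memE[OF U] by blast
  obtain W' where W': "zariski_open R W'" "Z \<subseteq> W'" "W' \<subseteq> V"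
    "\<And>P. P \<in> W' \<Longrightarrow> t \<notin> P \<and> \<tau> P = stalk_frac R P b t"
    using loc_frac_memE[OF V] by blast
  show "germ R Z (U \<inter> V) (restrict \<sigma> (U \<inter> V) \<oplus>\<^bsub>sections R (U \<inter> V)\<^esub> restrict \<tau> (U \<inter> V))
      = loc_frac R T h (a \<otimes> t \<oplus> b \<otimes> s) (s \<otimes> t)"
  proof (rule loc_frac_eq_germ)
    show "zariski_open R (W \<inter> W')" by (rule zariski_open_Int[OF R.is_cring W(1) W'(1)])
    show "Z \<subseteq> W \<inter> W'" "W \<inter> W' \<subseteq> U \<inter> V" using W W' by auto
    fix P assume P: "P \<in> W \<inter> W'"
    then have PS: "P \<in> Spec R" using zariski_open_subset[OF W(1)] by blast
    have "s \<notin> P" "t \<notin> P" "\<sigma> P = stalk_frac R P a s" "\<tau> P = stalk_frac R P b t" "P \<in> U" "P \<in> V"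
      using P W(3) W'(3) W(4)[of P] W'(4)[of P] by auto
    then show "s \<otimes> t \<notin> P \<and> (restrict \<sigma> (U \<inter> V) \<oplus>\<^bsub>sections R (U \<inter> V)\<^esub> restrict \<tau> (U \<inter> V)) P
        = stalk_frac R P (a \<otimes> t \<oplus> b \<otimes> s) (s \<otimes> t)"
      using ab Spec_mult_iff[OF R.is_cring PS] stalk_add[OF PS] by (simp add: sections_def)
  qed
qed

lemma loc_frac_unit:
  assumes "\<And>P. P \<in> Spec R \<Longrightarrow> \<sigma> P = stalk_frac R P a \<one>"
  shows "germ R Z (Spec R) \<sigma> = loc_frac R T h a \<one>"
proof (rule loc_frac_eq_germ)
  show "zariski_open R (Spec R)"
    using zariski_open_basic[OF R.is_cring, of \<one>] by (simp add: basic_open_one[OF R.is_cring])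
qed (use Z_subset_Spec Spec_one_notin[OF R.is_cring] assms in auto)

lemma carrier_germs: "carrier (germs R Z) = {loc_frac R T h a s | a s. a \<in> carrier R \<and> s \<in> M}"
proof (intro equalityI subsetI)
  fix x assume "x \<in> carrier (germs R Z)"
  then obtain U \<sigma> where x: "x = germ R Z U \<sigma>" and U: "zariski_open R U" "Z \<subseteq> U"
    "\<sigma> \<in> carrier (sections R U)" by (auto simp: germs_def)
  obtain a s W where as: "a \<in> carrier R" "s \<in> M" and W: "zariski_open R W" "Z \<subseteq> W" "W \<subseteq> U"
    "\<And>P. P \<in> W \<Longrightarrow> s \<notin> P \<and> \<sigma> P = stalk_frac R P a s"
    using section_near_Z[OF U] by metis
  have "x = loc_frac R T h a s" unfolding x by (rule loc_frac_eq_germ[OF W])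
  then show "x \<in> {loc_frac R T h a s | a s. a \<in> carrier R \<and> s \<in> M}"
    using as by blast
next
  fix x assume "x \<in> {loc_frac R T h a s | a s. a \<in> carrier R \<and> s \<in> M}"
  then obtain a s where x: "x = loc_frac R T h a s" and "a \<in> carrier R" "s \<in> M" by blast
  then have "zariski_open R (basic_open R s)" "Z \<subseteq> basic_open R s"
    "(\<lambda>P\<in>basic_open R s. stalk_frac R P a s) \<in> carrier (sections R (basic_open R s))"
    using zariski_open_basic[OF R.is_cring] section_basic[OF R.is_cring] Z_subset_basic_open[of s]
    by auto
  then show "x \<in> carrier (germs R Z)"
    unfolding x loc_frac_def germs_def partial_object.simps by blast
qed

text \<open>Identifies the colimit of sections over neighbourhoods of \<open>Z\<close> with the ring
  of fractions of \<open>R\<close> at \<open>M\<close>. The ring laws and the comparison of homotopy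
  groups are drawn from this presentation.\<close>

lemma fraction_presentation_loc:
  "fraction_presentation R M (loc_ring R T h) (loc_frac R T h)"
proof
  show "carrier (loc_ring R T h) = {loc_frac R T h a s | a s. a \<in> carrier R \<and> s \<in> M}"
    unfolding loc_ring_def by (rule carrier_germs)
  show "\<one>\<^bsub>loc_ring R T h\<^esub> = loc_frac R T h \<one> \<one>"
    unfolding loc_ring_def germs_def monoid.simps
    by (rule loc_frac_unit) (simp add: sections_def frac_ring_def)
  show "\<zero>\<^bsub>loc_ring R T h\<^esub> = loc_frac R T h \<zero> \<one>"
    unfolding loc_ring_def germs_def ring.simps
    by (rule loc_frac_unit) (simp add: sections_def frac_ring_def)
qed (unfold loc_ring_def, fact loc_frac_eq_iff, fact loc_frac_mult, fact loc_frac_add)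

lemma loc_unit_eq: "loc_unit R T h a = loc_frac R T h a \<one>"
  unfolding loc_unit_def by (rule loc_frac_unit) simp

text \<open>Since \<open>comp\<close> makes \<open>\<theta>\<close> respect the kernels, Spec of
  \<open>\<theta>\<close> maps \<open>R'.Z\<close> into \<open>Z\<close>. A neighbourhood of
  \<open>Z\<close> on which a section is a/s thus pulls back to a neighbourhood of
  \<open>R'.Z\<close>, on which the pulled back section is the image fraction.\<close>

lemma loc_map_loc_frac:
  assumes R': "surj_ring_hom R' T h'" and \<theta>: "\<theta> \<in> ring_hom R R'"
    and comp: "\<And>x. x \<in> carrier R \<Longrightarrow> h' (\<theta> x) = h x"
    and a: "a \<in> carrier R" and s: "s \<in> M"
  shows "loc_map R R' T h' \<theta> (loc_frac R T h a s) = loc_frac R' T h' (\<theta> a) (\<theta> s)"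
proof -
  interpret R': surj_ring_hom R' T h' by (rule R')
  have \<theta>P: "Spec_map R \<theta> Q \<in> Spec R" if "Q \<in> Spec R'" for Q
    using ring_hom_ring.primeideal_vimage[OF _ R.is_cring, of R' \<theta> Q] that \<theta>
    by (simp add: Spec_def Spec_map_def ring_hom_ringI2 R.ring_axioms R'.R.ring_axioms)
  have \<theta>Z: "Spec_map R \<theta> Q \<in> Z" if "Q \<in> R'.Z" for Q
  proof -
    have "Q \<in> Spec R'" and ker: "\<And>x. \<lbrakk>x \<in> carrier R'; h' x = \<zero>\<^bsub>T\<^esub>\<rbrakk> \<Longrightarrow> x \<in> Q"
      using that unfolding R'.Z_eq by auto
    then show ?thesis
      unfolding Z_eq using \<theta>P comp ring_hom_closed[OF \<theta>] by (auto simp: Spec_map_def)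
  qed
  show ?thesis
    unfolding loc_map_def
  proof (rule UN_pair_const[OF loc_frac_self[OF a s]])
    fix U \<sigma> assume "(U, \<sigma>) \<in> loc_frac R T h a s"
    then obtain W where W: "zariski_open R W" "Z \<subseteq> W" "W \<subseteq> U"
      and eq: "\<And>P. P \<in> W \<Longrightarrow> s \<notin> P \<and> \<sigma> P = stalk_frac R P a s"
      by (rule loc_frac_memE) blast
    show "germ R' R'.Z (pull_open R R' \<theta> U) (pull_section R R' \<theta> U \<sigma>) = loc_frac R' T h' (\<theta> a) (\<theta> s)"
    proof (rule R'.loc_frac_eq_germ)
      obtain J where J: "J \<subseteq> carrier R" "W = {P \<in> Spec R. \<not> J \<subseteq> P}"
        using W(1) by (auto simp: zariski_open_def)
      show "zariski_open R' (pull_open R R' \<theta> W)"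
        unfolding zariski_open_def
      proof (intro exI[of _ "\<theta> ` J"] conjI)
        show "\<theta> ` J \<subseteq> carrier R'" using J ring_hom_closed[OF \<theta>] by blast
        show "pull_open R R' \<theta> W = {P \<in> Spec R'. \<not> \<theta> ` J \<subseteq> P}"
          using J \<theta>P by (auto simp: pull_open_def Spec_map_def)
      qed
      show "R'.Z \<subseteq> pull_open R R' \<theta> W"
        using W(2) \<theta>Z R'.Z_subset_Spec unfolding pull_open_def by blast
      show "pull_open R R' \<theta> W \<subseteq> pull_open R R' \<theta> U"
        using W(3) by (auto simp: pull_open_def)
      fix Q assume Q: "Q \<in> pull_open R R' \<theta> W"
      then have QS: "Q \<in> Spec R'" and QW: "Spec_map R \<theta> Q \<in> W" by (auto simp: pull_open_def)
      have notin: "\<theta> x \<in> carrier R' - Q" if "x \<in> carrier R - Spec_map R \<theta> Q" for x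
        using that ring_hom_closed[OF \<theta>] by (auto simp: Spec_map_def)
      have sS: "s \<in> carrier R - Spec_map R \<theta> Q" using eq[OF QW] s by blast
      have "stalk_map R' \<theta> Q (stalk_frac R (Spec_map R \<theta> Q) a s) = stalk_frac R' Q (\<theta> a) (\<theta> s)"
        unfolding stalk_map_def
        by (rule frac_cring.Union_frac_map[OF Spec_stalk[OF R.is_cring \<theta>P[OF QS]]
              Spec_stalk[OF R'.R.is_cring QS] \<theta> notin a sS])
      moreover have "Spec_map R \<theta> Q \<in> U" using QW W(3) by blast
      ultimately show "\<theta> s \<notin> Q \<and> pull_section R R' \<theta> U \<sigma> Q = stalk_frac R' Q (\<theta> a) (\<theta> s)"
        using notin[OF sS] eq[OF QW] QS by (simp add: pull_section_def pull_open_def)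
    qed
  qed
qed

end


section \<open>The action of a simplicial ring on its homotopy groups\<close>

context simplicial_cring
begin

sublocale L: cring "lev A n" for n
  by (rule lev_cring)

lemma face_ring_hom_cring: "i \<le> Suc n \<Longrightarrow> ring_hom_cring (lev A (Suc n)) (lev A n) (face A n i)"
  by (intro ring_hom_cring.intro ring_hom_cring_axioms.intro lev_cring face_hom)

lemma face_closed [simp]:
  "\<lbrakk>i \<le> Suc n; x \<in> carrier (lev A (Suc n))\<rbrakk> \<Longrightarrow> face A n i x \<in> carrier (lev A n)"
  using ring_hom_closed[OF face_hom] .

lemma degen_closed [simp]:
  "\<lbrakk>i \<le> n; x \<in> carrier (lev A n)\<rbrakk> \<Longrightarrow> degen A n i x \<in> carrier (lev A (Suc n))"
  using ring_hom_closed[OF degen_hom] .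

lemma face_add:
  "\<lbrakk>i \<le> Suc n; x \<in> carrier (lev A (Suc n)); y \<in> carrier (lev A (Suc n))\<rbrakk>
    \<Longrightarrow> face A n i (x \<oplus>\<^bsub>lev A (Suc n)\<^esub> y) = face A n i x \<oplus>\<^bsub>lev A n\<^esub> face A n i y"
  using ring_hom_add[OF face_hom] .

lemma face_mult:
  "\<lbrakk>i \<le> Suc n; x \<in> carrier (lev A (Suc n)); y \<in> carrier (lev A (Suc n))\<rbrakk>
    \<Longrightarrow> face A n i (x \<otimes>\<^bsub>lev A (Suc n)\<^esub> y) = face A n i x \<otimes>\<^bsub>lev A n\<^esub> face A n i y"
  using ring_hom_mult[OF face_hom] .

lemma face_zero: "i \<le> Suc n \<Longrightarrow> face A n i \<zero>\<^bsub>lev A (Suc n)\<^esub> = \<zero>\<^bsub>lev A n\<^esub>"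
  using ring_hom_zero[OF face_hom L.ring_axioms L.ring_axioms] .

lemma face_a_inv:
  assumes "i \<le> Suc n" "x \<in> carrier (lev A (Suc n))"
  shows "face A n i (\<ominus>\<^bsub>lev A (Suc n)\<^esub> x) = \<ominus>\<^bsub>lev A n\<^esub> face A n i x"
proof -
  interpret ring_hom_cring "lev A (Suc n)" "lev A n" "face A n i"
    by (rule face_ring_hom_cring[OF assms(1)])
  show ?thesis using assms(2) by simp
qed

lemma face_minus:
  "\<lbrakk>i \<le> Suc n; x \<in> carrier (lev A (Suc n)); y \<in> carrier (lev A (Suc n))\<rbrakk>
    \<Longrightarrow> face A n i (x \<ominus>\<^bsub>lev A (Suc n)\<^esub> y) = face A n i x \<ominus>\<^bsub>lev A n\<^esub> face A n i y"
  by (simp add: L.minus_eq face_add face_a_inv)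

lemma degen_zero: "i \<le> n \<Longrightarrow> degen A n i \<zero>\<^bsub>lev A n\<^esub> = \<zero>\<^bsub>lev A (Suc n)\<^esub>"
  using ring_hom_zero[OF degen_hom L.ring_axioms L.ring_axioms] .

section \<open>Cycles and boundaries of the normalised complex\<close>

lemma cycles_carrier: "x \<in> cycles A n \<Longrightarrow> x \<in> carrier (lev A n)"
  by (simp add: cycles_def)

lemma boundaries_carrier: "x \<in> boundaries A n \<Longrightarrow> x \<in> carrier (lev A n)"
  by (auto simp: boundaries_def)

lemma boundariesI:
  assumes "y \<in> carrier (lev A (Suc n))"
    and "\<And>i. \<lbrakk>1 \<le> i; i \<le> Suc n\<rbrakk> \<Longrightarrow> face A n i y = \<zero>\<^bsub>lev A n\<^esub>"
  shows "face A n 0 y \<in> boundaries A n"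
  using assms by (auto simp: boundaries_def)

lemma boundariesE:
  assumes "x \<in> boundaries A n"
  obtains y where "y \<in> carrier (lev A (Suc n))" "x = face A n 0 y"
    "\<And>i. \<lbrakk>1 \<le> i; i \<le> Suc n\<rbrakk> \<Longrightarrow> face A n i y = \<zero>\<^bsub>lev A n\<^esub>"
  using assms by (auto simp: boundaries_def)

lemma boundaries_subset_cycles: "boundaries A n \<subseteq> cycles A n"
proof
  fix x assume "x \<in> boundaries A n"
  then obtain y where y: "y \<in> carrier (lev A (Suc n))" "x = face A n 0 y"
    "\<And>i. \<lbrakk>1 \<le> i; i \<le> Suc n\<rbrakk> \<Longrightarrow> face A n i y = \<zero>\<^bsub>lev A n\<^esub>"
    by (rule boundariesE) blast
  \<comment> \<open>d_i d_0 y = d_0 d_{i+1} y, and face i+1 of \<open>y\<close> is zero.\<close>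
  have "face A m i x = \<zero>\<^bsub>lev A m\<^esub>" if "n = Suc m" "i \<le> n" for m i
    using that y(1,2) y(3)[of "Suc i"] face_face[of 0 i m y] by (simp add: face_zero)
  then show "x \<in> cycles A n" using y by (simp add: cycles_def)
qed

lemma subgroup_cycles: "subgroup (cycles A n) (add_monoid (lev A n))"
proof (rule L.add.subgroupI)
  show "cycles A n \<subseteq> carrier (lev A n)" by (auto simp: cycles_def)
  show "cycles A n \<noteq> {}" by (auto simp: cycles_def face_zero intro!: exI[of _ "\<zero>\<^bsub>lev A n\<^esub>"])
qed (auto simp: cycles_def face_add face_a_inv)

lemma ideal_boundaries: "ideal (boundaries A n) (lev A n)"
proof (rule idealI[OF L.ring_axioms])
  have mult: "r \<otimes>\<^bsub>lev A n\<^esub> x \<in> boundaries A n"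
    if x: "x \<in> boundaries A n" and r: "r \<in> carrier (lev A n)" for x r
  proof -
    obtain y where y: "y \<in> carrier (lev A (Suc n))" "x = face A n 0 y"
      "\<And>i. \<lbrakk>1 \<le> i; i \<le> Suc n\<rbrakk> \<Longrightarrow> face A n i y = \<zero>\<^bsub>lev A n\<^esub>"
      using boundariesE[OF x] by blast
    \<comment> \<open>Multiplying by s_0 r keeps the vanishing faces of \<open>y\<close> zero and
      multiplies face 0 by d_0 s_0 r = r.\<close>
    have "face A n 0 (degen A n 0 r \<otimes>\<^bsub>lev A (Suc n)\<^esub> y) \<in> boundaries A n"
      using y r by (intro boundariesI) (auto simp: face_mult)
    then show ?thesis using y r by (simp add: face_mult face_degen_same)
  qed
  then show "\<And>a x. \<lbrakk>a \<in> boundaries A n; x \<in> carrier (lev A n)\<rbrakk> \<Longrightarrow> x \<otimes>\<^bsub>lev A n\<^esub> a \<in> boundaries A n" .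
  show "a \<otimes>\<^bsub>lev A n\<^esub> x \<in> boundaries A n" if "a \<in> boundaries A n" "x \<in> carrier (lev A n)" for a x
    using mult[OF that] that boundaries_carrier L.m_comm by metis
  show "subgroup (boundaries A n) (add_monoid (lev A n))"
  proof (rule L.add.subgroupI)
    show "boundaries A n \<subseteq> carrier (lev A n)" using boundaries_carrier by auto
    have "face A n 0 \<zero>\<^bsub>lev A (Suc n)\<^esub> \<in> boundaries A n" by (intro boundariesI) (auto simp: face_zero)
    then show "boundaries A n \<noteq> {}" by blast
  next
    fix a assume a: "a \<in> boundaries A n"
    have "\<ominus>\<^bsub>lev A n\<^esub> a = (\<ominus>\<^bsub>lev A n\<^esub> \<one>\<^bsub>lev A n\<^esub>) \<otimes>\<^bsub>lev A n\<^esub> a"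
      using boundaries_carrier[OF a] by (simp add: L.l_minus)
    then show "\<ominus>\<^bsub>lev A n\<^esub> a \<in> boundaries A n"
      using mult[OF a, of "\<ominus>\<^bsub>lev A n\<^esub> \<one>\<^bsub>lev A n\<^esub>"] by simp
  next
    fix a b assume "a \<in> boundaries A n" "b \<in> boundaries A n"
    then obtain y z where y: "y \<in> carrier (lev A (Suc n))" "a = face A n 0 y"
      "\<And>i. \<lbrakk>1 \<le> i; i \<le> Suc n\<rbrakk> \<Longrightarrow> face A n i y = \<zero>\<^bsub>lev A n\<^esub>"
      and z: "z \<in> carrier (lev A (Suc n))" "b = face A n 0 z"
      "\<And>i. \<lbrakk>1 \<le> i; i \<le> Suc n\<rbrakk> \<Longrightarrow> face A n i z = \<zero>\<^bsub>lev A n\<^esub>"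
      by (elim boundariesE) blast
    have "face A n 0 (y \<oplus>\<^bsub>lev A (Suc n)\<^esub> z) \<in> boundaries A n"
      using y z by (intro boundariesI) (auto simp: face_add)
    then show "a \<oplus>\<^bsub>lev A n\<^esub> b \<in> boundaries A n"
      using y z by (simp add: face_add)
  qed
qed

sublocale Bd: ideal "boundaries A n" "lev A n" for n
  by (rule ideal_boundaries)

lemma cycles_face:
  "\<lbrakk>x \<in> cycles A (Suc m); i \<le> Suc m\<rbrakk> \<Longrightarrow> face A m i x = \<zero>\<^bsub>lev A m\<^esub>"
  by (simp add: cycles_def)

text \<open>For these indices the simplicial identities move the face past the degeneracy, which
  leaves a degeneracy of a face of the cycle. In degree 0 no such index exists.\<close>

lemma face_degen_cycle:
  assumes x: "x \<in> cycles A n" and i: "i \<le> Suc n" and j: "j \<le> n" and ij: "i \<noteq> j" "i \<noteq> Suc j"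
  shows "face A n i (degen A n j x) = \<zero>\<^bsub>lev A n\<^esub>"
proof (cases "i < j")
  case True
  then obtain j' m where [simp]: "j = Suc j'" "n = Suc m" using j by (cases j; cases n) auto
  show ?thesis
    using True j cycles_carrier[OF x] x face_degen_lower[of i j' m x] cycles_face[of x m i] by (simp add: degen_zero)
next
  case False
  then obtain i' m where [simp]: "i = Suc i'" "n = Suc m" using i j ij by (cases i; cases n) auto
  show ?thesis
    using False i ij cycles_carrier[OF x] x face_degen_upper[of j i' m x] cycles_face[of x m i'] by (simp add: degen_zero)
qed

text \<open>In \<open>boundaries\<close> only face 0 may be nonzero; here any one face may be. The
  induction moves the nonzero face one index down without changing its value.\<close>

lemma single_face_boundary:
  assumes "j \<le> Suc n" and "y \<in> carrier (lev A (Suc n))"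
    and "\<And>i. \<lbrakk>i \<le> Suc n; i \<noteq> j\<rbrakk> \<Longrightarrow> face A n i y = \<zero>\<^bsub>lev A n\<^esub>"
  shows "face A n j y \<in> boundaries A n"
  using assms
proof (induction j arbitrary: y)
  case 0
  then show ?case by (intro boundariesI) auto
next
  case (Suc j)
  define w where "w = face A n (Suc j) y"
  have wc: "w \<in> carrier (lev A n)" using Suc.prems by (simp add: w_def)
  have w: "w \<in> cycles A n"
  proof -
    have "face A m i w = \<zero>\<^bsub>lev A m\<^esub>" if n: "n = Suc m" and i: "i \<le> n" for m i
    proof (cases "i \<le> j")
      case True
      then show ?thesis
        using Suc.prems n i face_face[of i j m y] Suc.prems(3)[of i] by (simp add: w_def face_zero)
    next
      case False
      then show ?thesis
        using Suc.prems n i face_face[of "Suc j" i m y] Suc.prems(3)[of "Suc i"]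
        by (simp add: w_def face_zero)
    qed
    then show ?thesis using wc by (simp add: cycles_def)
  qed
  have jn: "j \<le> n" using Suc.prems by simp
  \<comment> \<open>s_j w has \<open>w\<close> as faces j and j+1 and no other nonzero face.
    Subtracting \<open>y\<close> cancels face j+1 and leaves \<open>w\<close> at face j, where
    \<open>y\<close> vanishes.\<close>
  define z where "z = degen A n j w \<ominus>\<^bsub>lev A (Suc n)\<^esub> y"
  have z: "z \<in> carrier (lev A (Suc n))" using Suc.prems wc jn by (simp add: z_def)
  have fz: "face A n i z = face A n i (degen A n j w) \<ominus>\<^bsub>lev A n\<^esub> face A n i y" if "i \<le> Suc n" for i
    using that Suc.prems wc jn by (simp add: z_def face_minus)
  have "face A n j z \<in> boundaries A n"
  proof (rule Suc.IH[OF _ z])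
    show "j \<le> Suc n" using jn by simp
    fix i assume i: "i \<le> Suc n" "i \<noteq> j"
    show "face A n i z = \<zero>\<^bsub>lev A n\<^esub>"
    proof (cases "i = Suc j")
      case True
      then show ?thesis using fz[OF i(1)] face_degen_next[OF jn wc] wc by (simp add: w_def L.minus_eq L.r_neg)
    next
      case False
      then show ?thesis
        using fz[OF i(1)] face_degen_cycle[OF w i(1) jn i(2) False] Suc.prems(3)[OF i(1) False]
        by (simp add: L.minus_eq)
    qed
  qed
  moreover have "face A n j z = w"
    using fz[of j] jn face_degen_same[OF jn wc] Suc.prems(3)[of j] wc by (simp add: L.minus_eq)
  ultimately show ?case by (simp add: w_def)
qed

section \<open>Elements with the same action on a homotopy group\<close>

definition same_action :: "nat \<Rightarrow> 'a \<Rightarrow> 'a \<Rightarrow> bool" where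
  "same_action n a b \<longleftrightarrow> (\<forall>x\<in>cycles A n. (a \<ominus>\<^bsub>lev A n\<^esub> b) \<otimes>\<^bsub>lev A n\<^esub> x \<in> boundaries A n)"

lemma same_action_sym:
  assumes "same_action n a b" "a \<in> carrier (lev A n)" "b \<in> carrier (lev A n)"
  shows "same_action n b a"
  unfolding same_action_def
proof
  fix x assume x: "x \<in> cycles A n"
  have "(b \<ominus>\<^bsub>lev A n\<^esub> a) \<otimes>\<^bsub>lev A n\<^esub> x = \<ominus>\<^bsub>lev A n\<^esub> ((a \<ominus>\<^bsub>lev A n\<^esub> b) \<otimes>\<^bsub>lev A n\<^esub> x)"
    using x assms cycles_carrier[OF x]
    by (simp add: L.minus_eq L.l_distr L.l_minus L.minus_add L.a_comm)
  then show "(b \<ominus>\<^bsub>lev A n\<^esub> a) \<otimes>\<^bsub>lev A n\<^esub> x \<in> boundaries A n"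
    using assms(1) x by (simp add: same_action_def)
qed

lemma same_action_trans:
  assumes "same_action n a b" "same_action n b c"
    and "a \<in> carrier (lev A n)" "b \<in> carrier (lev A n)" "c \<in> carrier (lev A n)"
  shows "same_action n a c"
  unfolding same_action_def
proof
  fix x assume x: "x \<in> cycles A n"
  have "\<ominus>\<^bsub>lev A n\<^esub> b \<oplus>\<^bsub>lev A n\<^esub> (b \<oplus>\<^bsub>lev A n\<^esub> \<ominus>\<^bsub>lev A n\<^esub> c) = \<ominus>\<^bsub>lev A n\<^esub> c"
    using assms by (simp add: L.r_neg1)
  then have "a \<ominus>\<^bsub>lev A n\<^esub> c = (a \<ominus>\<^bsub>lev A n\<^esub> b) \<oplus>\<^bsub>lev A n\<^esub> (b \<ominus>\<^bsub>lev A n\<^esub> c)"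
    using assms by (simp add: L.minus_eq L.a_assoc)
  then have "(a \<ominus>\<^bsub>lev A n\<^esub> c) \<otimes>\<^bsub>lev A n\<^esub> x
      = (a \<ominus>\<^bsub>lev A n\<^esub> b) \<otimes>\<^bsub>lev A n\<^esub> x \<oplus>\<^bsub>lev A n\<^esub> (b \<ominus>\<^bsub>lev A n\<^esub> c) \<otimes>\<^bsub>lev A n\<^esub> x"
    using assms cycles_carrier[OF x] by (simp add: L.l_distr)
  then show "(a \<ominus>\<^bsub>lev A n\<^esub> c) \<otimes>\<^bsub>lev A n\<^esub> x \<in> boundaries A n"
    using assms(1,2) x by (simp add: same_action_def)
qed

lemma same_action_adjacent_faces:
  assumes c: "c \<in> carrier (lev A (Suc n))" and j: "j \<le> n"
  shows "same_action n (face A n j c) (face A n (Suc j) c)"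
  unfolding same_action_def
proof
  fix x assume x: "x \<in> cycles A n"
  have xc: "x \<in> carrier (lev A n)" using x by (rule cycles_carrier)
  have dc: "face A n (Suc j) c \<in> carrier (lev A n)" using c j by simp
  \<comment> \<open>Faces j and j+1 of the subtracted degeneracy both equal d_{j+1} c. So face j+1
    of \<open>d\<close> is zero and face j is the difference under study; the other faces of
    \<open>d\<close> are irrelevant, since those of s_j x vanish.\<close>
  define d where "d = c \<ominus>\<^bsub>lev A (Suc n)\<^esub> degen A n j (face A n (Suc j) c)"
  have d: "d \<in> carrier (lev A (Suc n))" using c j by (simp add: d_def)
  let ?y = "d \<otimes>\<^bsub>lev A (Suc n)\<^esub> degen A n j x"
  have fy: "face A n i ?y = face A n i d \<otimes>\<^bsub>lev A n\<^esub> face A n i (degen A n j x)" if "i \<le> Suc n" for i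
    using that d j xc by (simp add: face_mult)
  have fj: "face A n j d = face A n j c \<ominus>\<^bsub>lev A n\<^esub> face A n (Suc j) c"
    using c j by (simp add: d_def face_minus face_degen_same[OF j dc])
  have fSj: "face A n (Suc j) d = \<zero>\<^bsub>lev A n\<^esub>"
    using c j by (simp add: d_def face_minus face_degen_next[OF j dc] L.r_right_minus_eq)
  have "face A n j ?y \<in> boundaries A n"
  proof (rule single_face_boundary)
    show "?y \<in> carrier (lev A (Suc n))" using d j xc by simp
    fix i assume i: "i \<le> Suc n" "i \<noteq> j"
    show "face A n i ?y = \<zero>\<^bsub>lev A n\<^esub>"
    proof (cases "i = Suc j")
      case True
      then show ?thesis using fy[OF i(1)] fSj face_degen_next[OF j xc] xc by simp
    next
      case False
      then show ?thesis
        using fy[OF i(1)] face_degen_cycle[OF x i(1) j i(2) False] i d by simp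
    qed
  qed (use j in simp)
  then show "(face A n j c \<ominus>\<^bsub>lev A n\<^esub> face A n (Suc j) c) \<otimes>\<^bsub>lev A n\<^esub> x \<in> boundaries A n"
    using fy[of j] j fj face_degen_same[OF j xc] by simp
qed

lemma same_action_faces:
  assumes c: "c \<in> carrier (lev A (Suc n))" and "i \<le> Suc n"
  shows "same_action n (face A n 0 c) (face A n i c)"
  using assms(2)
proof (induction i)
  case 0
  show ?case
    using c cycles_carrier by (auto simp: same_action_def L.minus_eq L.r_neg)
next
  case (Suc i)
  then show ?case
    using same_action_trans[OF Suc.IH same_action_adjacent_faces[OF c, of i]] c by simp
qed

text \<open>Pullback along the map of simplices from [m+k] to [m] that collapses the last k+1
  vertices to one. The last face removes one degeneracy, while d_0 passes through to
  \<open>a\<close>; both are needed at once in \<open>same_action_last_degen\<close>.\<close>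

primrec last_degen :: "nat \<Rightarrow> nat \<Rightarrow> 'a \<Rightarrow> 'a" where
  "last_degen m 0 a = a"
| "last_degen m (Suc k) a = degen A (m + k) (m + k) (last_degen m k a)"

lemma last_degen_closed: "a \<in> carrier (lev A m) \<Longrightarrow> last_degen m k a \<in> carrier (lev A (m + k))"
  by (induction k) simp_all

lemma face_last_last_degen:
  "a \<in> carrier (lev A m) \<Longrightarrow> face A (m + k) (Suc (m + k)) (last_degen m (Suc k) a) = last_degen m k a"
  by (simp add: face_degen_next last_degen_closed)

lemma face_0_last_degen:
  assumes "a \<in> carrier (lev A (Suc m))"
  shows "face A (m + k) 0 (last_degen (Suc m) k a) = last_degen m k (face A m 0 a)"
proof (induction k)
  case (Suc k)
  then show ?case
    using face_degen_lower[of 0 "m + k" "m + k" "last_degen (Suc m) k a"]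
      last_degen_closed[OF assms, of k] by simp
qed simp

lemma vertex_closed: "a \<in> carrier (lev A n) \<Longrightarrow> vertex A n a \<in> carrier (lev A 0)"
  by (induction n arbitrary: a) simp_all

text \<open>The element \<open>?c\<close> has \<open>a\<close>, degenerated k times, as its last
  face and d_0 a, degenerated k+1 times, as its face 0. All faces of one element act alike, so
  \<open>a\<close> may be replaced by d_0 a until only its vertex is left. The level m+k stays fixed
  while m falls, hence the general k.\<close>

lemma same_action_last_degen:
  "a \<in> carrier (lev A m)
    \<Longrightarrow> same_action (m + k) (last_degen m k a) (last_degen 0 (m + k) (vertex A m a))"
proof (induction m arbitrary: k a)
  case 0
  then show ?case
    using last_degen_closed[of a 0 k] cycles_carrier by (auto simp: same_action_def L.minus_eq L.r_neg)
next
  case (Suc m)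
  have fa: "face A m 0 a \<in> carrier (lev A m)" using Suc.prems by simp
  let ?c = "last_degen (Suc m) (Suc k) a"
  have c: "?c \<in> carrier (lev A (Suc (Suc m + k)))" using last_degen_closed[OF Suc.prems, of "Suc k"] by simp
  have "same_action (Suc m + k) (face A (Suc m + k) 0 ?c) (face A (Suc m + k) (Suc (Suc m + k)) ?c)"
    by (rule same_action_faces[OF c]) simp
  then have 1: "same_action (Suc m + k) (last_degen m (Suc k) (face A m 0 a)) (last_degen (Suc m) k a)"
    using face_last_last_degen[OF Suc.prems, of k] face_0_last_degen[OF Suc.prems, of "Suc k"] by simp
  have 2: "same_action (Suc m + k) (last_degen m (Suc k) (face A m 0 a))
      (last_degen 0 (Suc m + k) (vertex A (Suc m) a))"
    using Suc.IH[OF fa, of "Suc k"] by simp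
  have l: "last_degen m (Suc k) (face A m 0 a) \<in> carrier (lev A (Suc m + k))"
    "last_degen (Suc m) k a \<in> carrier (lev A (Suc m + k))"
    "last_degen 0 (Suc m + k) (vertex A (Suc m) a) \<in> carrier (lev A (Suc m + k))"
    using last_degen_closed[OF fa, of "Suc k"] last_degen_closed[OF Suc.prems, of k]
      last_degen_closed[OF vertex_closed[OF Suc.prems], of "Suc m + k"] by simp_all
  show ?case by (rule same_action_trans[OF same_action_sym[OF 1] 2]) (use l in simp_all)
qed

lemma same_action_vertex:
  assumes "a \<in> carrier (lev A n)" "b \<in> carrier (lev A n)" "vertex A n a = vertex A n b"
  shows "same_action n a b"
proof -
  have "last_degen 0 n (vertex A n a) \<in> carrier (lev A n)"
    using last_degen_closed[OF vertex_closed[OF assms(1)], of n] by simp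
  then show ?thesis
    using same_action_last_degen[OF assms(1), of 0] same_action_last_degen[OF assms(2), of 0] assms
    by (auto intro: same_action_trans same_action_sym)
qed

text \<open>Spreads an edge e over a simplex: vertices 0 to k go to the start of e and the last
  vertex to its end. So repeated d_0 leads to d_0 e, and the last face is an iterated degeneracy of
  d_1 e.\<close>

primrec first_degen :: "nat \<Rightarrow> 'a \<Rightarrow> 'a" where
  "first_degen 0 e = e"
| "first_degen (Suc k) e = degen A (Suc k) 0 (first_degen k e)"

lemma first_degen_closed: "e \<in> carrier (lev A 1) \<Longrightarrow> first_degen k e \<in> carrier (lev A (Suc k))"
  by (induction k) simp_all

lemma vertex_degen_0: "a \<in> carrier (lev A n) \<Longrightarrow> vertex A (Suc n) (degen A n 0 a) = vertex A n a"
  by (simp add: face_degen_same)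

lemma vertex_first_degen:
  assumes "e \<in> carrier (lev A 1)"
  shows "vertex A (Suc k) (first_degen k e) = face A 0 0 e"
proof (induction k)
  case (Suc k)
  then show ?case
    using vertex_degen_0[OF first_degen_closed[OF assms, of k]] by simp
qed simp

lemma face_last_first_degen:
  assumes "e \<in> carrier (lev A 1)" "face A 0 1 e = \<zero>\<^bsub>lev A 0\<^esub>"
  shows "face A k (Suc k) (first_degen k e) = \<zero>\<^bsub>lev A k\<^esub>"
proof (induction k)
  case (Suc k)
  then show ?case
    using face_degen_upper[of 0 "Suc k" k "first_degen k e"] first_degen_closed[OF assms(1), of k]
    by (simp add: degen_zero)
qed (use assms in simp)

text \<open>An element $a$ that vanishes in $\pi_0(A)$ has the same vertex as $d_0 c$ for a degenerate
  simplex $c$ whose last face is zero.\<close>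

lemma kernel_pi0_mult_cycle:
  assumes a: "a \<in> carrier (lev A n)" and va: "vertex A n a \<in> boundaries A 0" and x: "x \<in> cycles A n"
  shows "a \<otimes>\<^bsub>lev A n\<^esub> x \<in> boundaries A n"
proof -
  obtain e where e: "e \<in> carrier (lev A 1)" "vertex A n a = face A 0 0 e" "face A 0 1 e = \<zero>\<^bsub>lev A 0\<^esub>"
    using boundariesE[OF va] by (metis One_nat_def le_refl)
  let ?c = "first_degen n e"
  have c: "?c \<in> carrier (lev A (Suc n))" by (rule first_degen_closed[OF e(1)])
  have "vertex A n a = vertex A n (face A n 0 ?c)"
    using vertex_first_degen[OF e(1), of n] e(2) by simp
  then have 1: "same_action n a (face A n 0 ?c)" using a c by (intro same_action_vertex) simp_all
  \<comment> \<open>Faces 0 and n+1 of \<open>?c\<close> act alike, and the latter is zero because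
    face 1 of \<open>e\<close> is.\<close>
  have 2: "same_action n (face A n 0 ?c) \<zero>\<^bsub>lev A n\<^esub>"
    using same_action_faces[OF c, of "Suc n"] face_last_first_degen[OF e(1,3), of n] by simp
  have "same_action n a \<zero>\<^bsub>lev A n\<^esub>"
    by (rule same_action_trans[OF 1 2]) (use a c in simp_all)
  then show ?thesis using x a cycles_carrier[OF x] by (simp add: same_action_def L.minus_eq)
qed

end


section \<open>The simplicial ring of the localisation\<close>

context simplicial_cring
begin

lemma vertex_hom: "vertex A n \<in> ring_hom (lev A n) (lev A 0)"
proof (induction n)
  case 0
  show ?case by (rule ring_hom_memI) simp_all
next
  case (Suc n)
  have eq: "vertex A (Suc n) = vertex A n \<circ> face A n 0" by (rule ext) simp
  show ?case unfolding eq by (rule ring_hom_trans[OF face_hom Suc.IH]) simp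
qed

lemma cring_pi0: "cring (pi0_ring A)"
  unfolding pi0_ring_def by (rule Bd.quotient_is_cring[OF lev_cring])

lemma to_pi0_hom: "to_pi0 A n \<in> ring_hom (lev A n) (pi0_ring A)"
proof -
  have "to_pi0 A n = (+>\<^bsub>lev A 0\<^esub>) (boundaries A 0) \<circ> vertex A n"
    by (rule ext) (simp add: to_pi0_def)
  then show ?thesis
    unfolding pi0_ring_def using ring_hom_trans[OF vertex_hom Bd.rcos_ring_hom] by simp
qed

lemma to_pi0_surj: "to_pi0 A n ` carrier (lev A n) = carrier (pi0_ring A)"
proof
  show "to_pi0 A n ` carrier (lev A n) \<subseteq> carrier (pi0_ring A)"
    using ring_hom_closed[OF to_pi0_hom] by blast
  have "\<exists>a\<in>carrier (lev A n). vertex A n a = b" if "b \<in> carrier (lev A 0)" for b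
  proof (induction n)
    case (Suc n)
    then obtain a where a: "a \<in> carrier (lev A n)" "vertex A n a = b" by blast
    show ?case by (rule bexI[of _ "degen A n 0 a"]) (use a vertex_degen_0 in auto)
  qed (use that in simp)
  then show "carrier (pi0_ring A) \<subseteq> to_pi0 A n ` carrier (lev A n)"
    by (fastforce simp: pi0_ring_def FactRing_def A_RCOSETS_def' to_pi0_def)
qed

lemma surj_ring_hom_to_pi0: "surj_ring_hom (lev A n) (pi0_ring A) (to_pi0 A n)"
  by (intro surj_ring_hom.intro surj_ring_hom_axioms.intro ring_hom_cring.intro
      ring_hom_cring_axioms.intro lev_cring cring_pi0 to_pi0_hom to_pi0_surj)

interpretation Q: surj_ring_hom "lev A n" "pi0_ring A" "to_pi0 A n" for n
  by (rule surj_ring_hom_to_pi0)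

abbreviation "S n \<equiv> surj_ring_hom.M (lev A n) (pi0_ring A) (to_pi0 A n)"
abbreviation "G n \<equiv> loc_frac (lev A n) (pi0_ring A) (to_pi0 A n)"

lemma lev_l_sring: "lev (l_sring A) n = loc_ring (lev A n) (pi0_ring A) (to_pi0 A n)"
  by (simp add: l_sring_def)

interpretation F: fraction_presentation "lev A n" "S n" "lev (l_sring A) n" "G n" for n
  unfolding lev_l_sring by (rule Q.fraction_presentation_loc)

lemma to_pi0_eq_iff:
  assumes "a \<in> carrier (lev A n)" "b \<in> carrier (lev A m)"
  shows "to_pi0 A n a = to_pi0 A m b \<longleftrightarrow> vertex A n a \<ominus>\<^bsub>lev A 0\<^esub> vertex A m b \<in> boundaries A 0"
  unfolding to_pi0_def
  using L.quotient_eq_iff_same_a_r_cos[OF ideal_boundaries] vertex_closed assms by blast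

text \<open>Independence of the chosen vertex, which makes all structure maps of A maps over
  pi_0(A). As the vertex is taken with d_0, a face of index j+1 is exchanged with d_0 until only the
  two ends of an edge must be compared.\<close>

lemma to_pi0_face:
  "\<lbrakk>i \<le> Suc n; a \<in> carrier (lev A (Suc n))\<rbrakk> \<Longrightarrow> to_pi0 A n (face A n i a) = to_pi0 A (Suc n) a"
proof (induction n arbitrary: i a)
  case 0
  \<comment> \<open>The correction makes face 1 zero, so that d_0 y is a boundary; it equals the
    difference of the two ends of \<open>a\<close>.\<close>
  define y where "y = a \<ominus>\<^bsub>lev A (Suc 0)\<^esub> degen A 0 0 (face A 0 1 a)"
  have y: "y \<in> carrier (lev A (Suc 0))" using 0 by (simp add: y_def)
  have "face A 0 1 y = \<zero>\<^bsub>lev A 0\<^esub>"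
    using 0 face_degen_next[of 0 0 "face A 0 1 a"] by (simp add: y_def face_minus L.r_right_minus_eq)
  then have "face A 0 0 y \<in> boundaries A 0" using y by (intro boundariesI) (auto simp: le_Suc_eq)
  moreover have "face A 0 0 y = face A 0 0 a \<ominus>\<^bsub>lev A 0\<^esub> face A 0 1 a"
    using 0 face_degen_same[of 0 0 "face A 0 1 a"] by (simp add: y_def face_minus)
  ultimately have "to_pi0 A 0 (face A 0 0 a) = to_pi0 A 0 (face A 0 1 a)"
    using 0 by (simp add: to_pi0_eq_iff)
  then have "to_pi0 A 0 (face A 0 i a) = to_pi0 A 0 (face A 0 0 a)"
    using 0 by (cases i) auto
  then show ?case by (simp add: to_pi0_def)
next
  case (Suc n)
  show ?case
  proof (cases i)
    case 0
    then show ?thesis by (simp add: to_pi0_def)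
  next
    case i: (Suc j)
    have "to_pi0 A (Suc n) (face A (Suc n) i a) = to_pi0 A n (face A n j (face A (Suc n) 0 a))"
      using i Suc.prems face_face[of 0 j n a] by (simp add: to_pi0_def)
    also have "\<dots> = to_pi0 A (Suc n) (face A (Suc n) 0 a)"
      using i Suc.prems by (intro Suc.IH) simp_all
    also have "\<dots> = to_pi0 A (Suc (Suc n)) a" by (simp add: to_pi0_def)
    finally show ?thesis .
  qed
qed

lemma to_pi0_degen:
  assumes "i \<le> n" "a \<in> carrier (lev A n)"
  shows "to_pi0 A (Suc n) (degen A n i a) = to_pi0 A n a"
  using to_pi0_face[of i n "degen A n i a"] assms face_degen_same[OF assms] by simp

lemma S_iff: "s \<in> S n \<longleftrightarrow> s \<in> carrier (lev A n) \<and> to_pi0 A n s = \<one>\<^bsub>pi0_ring A\<^esub>"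
  unfolding Q.M_def by simp

lemma S_submonoid: "submonoid (S n) (lev A n)"
  by (rule frac_cring.axioms(2)) unfold_locales

lemmas S_one = submonoid.one_closed[OF S_submonoid]
  and S_mult = submonoid.m_closed[OF S_submonoid]

lemma S_face: "\<lbrakk>i \<le> Suc n; s \<in> S (Suc n)\<rbrakk> \<Longrightarrow> face A n i s \<in> S n"
  using S_iff to_pi0_face face_closed by metis

lemma S_degen: "\<lbrakk>i \<le> n; s \<in> S n\<rbrakk> \<Longrightarrow> degen A n i s \<in> S (Suc n)"
  using S_iff to_pi0_degen degen_closed by metis

lemma face_l_sring:
  assumes i: "i \<le> Suc n" and "a \<in> carrier (lev A (Suc n))" "s \<in> S (Suc n)"
  shows "face (l_sring A) n i (G (Suc n) a s) = G n (face A n i a) (face A n i s)"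
  using Q.loc_map_loc_frac[OF surj_ring_hom_to_pi0 face_hom[OF i] _ assms(2,3)] to_pi0_face[OF i]
  by (simp add: l_sring_def)

lemma degen_l_sring:
  assumes i: "i \<le> n" and "a \<in> carrier (lev A n)" "s \<in> S n"
  shows "degen (l_sring A) n i (G n a s) = G (Suc n) (degen A n i a) (degen A n i s)"
  using Q.loc_map_loc_frac[OF surj_ring_hom_to_pi0 degen_hom[OF i] _ assms(2,3)] to_pi0_degen[OF i]
  by (simp add: l_sring_def)

text \<open>Faces and degeneracies act on numerator and denominator separately, so each law is the
  same law in A applied to both.\<close>

lemma simplicial_cring_l_sring: "simplicial_cring (l_sring A)"
proof (rule simplicial_cring.intro)
  fix n show "cring (lev (l_sring A) n)" by (rule F.cring_B)
next
  fix i n assume i: "i \<le> Suc n"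
  show "face (l_sring A) n i \<in> ring_hom (lev (l_sring A) (Suc n)) (lev (l_sring A) n)"
  proof (rule ring_hom_memI)
    fix x assume "x \<in> carrier (lev (l_sring A) (Suc n))"
    then show "face (l_sring A) n i x \<in> carrier (lev (l_sring A) n)"
      using i by (elim F.G_cases) (simp add: face_l_sring S_face)
  next
    fix x y assume "x \<in> carrier (lev (l_sring A) (Suc n))" "y \<in> carrier (lev (l_sring A) (Suc n))"
    then show "face (l_sring A) n i (x \<otimes>\<^bsub>lev (l_sring A) (Suc n)\<^esub> y)
        = face (l_sring A) n i x \<otimes>\<^bsub>lev (l_sring A) n\<^esub> face (l_sring A) n i y"
      and "face (l_sring A) n i (x \<oplus>\<^bsub>lev (l_sring A) (Suc n)\<^esub> y)
        = face (l_sring A) n i x \<oplus>\<^bsub>lev (l_sring A) n\<^esub> face (l_sring A) n i y"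
      using i by (elim F.G_cases; simp add: face_l_sring S_face F.G_mult F.G_add face_mult face_add)+
  next
    show "face (l_sring A) n i \<one>\<^bsub>lev (l_sring A) (Suc n)\<^esub> = \<one>\<^bsub>lev (l_sring A) n\<^esub>"
      using i by (simp add: F.one_B face_l_sring ring_hom_one[OF face_hom])
  qed
next
  fix i n :: nat assume i: "i \<le> n"
  show "degen (l_sring A) n i \<in> ring_hom (lev (l_sring A) n) (lev (l_sring A) (Suc n))"
  proof (rule ring_hom_memI)
    fix x assume "x \<in> carrier (lev (l_sring A) n)"
    then show "degen (l_sring A) n i x \<in> carrier (lev (l_sring A) (Suc n))"
      using i by (elim F.G_cases) (simp add: degen_l_sring S_degen)
  next
    fix x y assume "x \<in> carrier (lev (l_sring A) n)" "y \<in> carrier (lev (l_sring A) n)"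
    then show "degen (l_sring A) n i (x \<otimes>\<^bsub>lev (l_sring A) n\<^esub> y)
        = degen (l_sring A) n i x \<otimes>\<^bsub>lev (l_sring A) (Suc n)\<^esub> degen (l_sring A) n i y"
      and "degen (l_sring A) n i (x \<oplus>\<^bsub>lev (l_sring A) n\<^esub> y)
        = degen (l_sring A) n i x \<oplus>\<^bsub>lev (l_sring A) (Suc n)\<^esub> degen (l_sring A) n i y"
      using i by (elim F.G_cases; simp add: degen_l_sring S_degen F.G_mult F.G_add
          ring_hom_mult[OF degen_hom] ring_hom_add[OF degen_hom])+
  next
    show "degen (l_sring A) n i \<one>\<^bsub>lev (l_sring A) n\<^esub> = \<one>\<^bsub>lev (l_sring A) (Suc n)\<^esub>"
      using i by (simp add: F.one_B degen_l_sring ring_hom_one[OF degen_hom])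
  qed
next
  fix i j n x assume "i \<le> j" "j \<le> Suc n" "x \<in> carrier (lev (l_sring A) (Suc (Suc n)))"
  then show "face (l_sring A) n i (face (l_sring A) (Suc n) (Suc j) x)
      = face (l_sring A) n j (face (l_sring A) (Suc n) i x)"
    by (elim F.G_cases) (simp add: face_l_sring S_face face_face)
next
  fix i j n x assume "i \<le> j" "j \<le> n" "x \<in> carrier (lev (l_sring A) n)"
  then show "degen (l_sring A) (Suc n) i (degen (l_sring A) n j x)
      = degen (l_sring A) (Suc n) (Suc j) (degen (l_sring A) n i x)"
    by (elim F.G_cases) (simp add: degen_l_sring S_degen degen_degen)
next
  fix i j n x assume "i \<le> j" "j \<le> n" "x \<in> carrier (lev (l_sring A) (Suc n))"
  then show "face (l_sring A) (Suc n) i (degen (l_sring A) (Suc n) (Suc j) x)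
      = degen (l_sring A) n j (face (l_sring A) n i x)"
    by (elim F.G_cases) (simp add: face_l_sring degen_l_sring S_face S_degen face_degen_lower)
next
  fix j n x assume "j \<le> n" "x \<in> carrier (lev (l_sring A) n)"
  then show "face (l_sring A) n j (degen (l_sring A) n j x) = x"
    and "face (l_sring A) n (Suc j) (degen (l_sring A) n j x) = x"
    by (elim F.G_cases; simp add: face_l_sring degen_l_sring S_degen face_degen_same face_degen_next)+
next
  fix i j n x assume "j < i" "i \<le> Suc n" "x \<in> carrier (lev (l_sring A) (Suc n))"
  then show "face (l_sring A) (Suc n) (Suc i) (degen (l_sring A) (Suc n) j x)
      = degen (l_sring A) n j (face (l_sring A) n i x)"
    by (elim F.G_cases) (simp add: face_l_sring degen_l_sring S_face S_degen face_degen_upper)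
qed

lemma l_unit_eq: "l_unit A n a = G n a \<one>\<^bsub>lev A n\<^esub>"
  by (simp add: l_unit_def Q.loc_unit_eq)

lemma sring_hom_l_unit: "sring_hom A (l_sring A) (l_unit A)"
  unfolding sring_hom_def l_unit_eq
  using F.G_of_one_hom face_l_sring degen_l_sring ring_hom_one[OF face_hom] ring_hom_one[OF degen_hom]
  by (auto simp: S_one)

section \<open>Cycles and boundaries of the localised ring\<close>

lemma S_mult_cycle:
  assumes s: "s \<in> S n" and x: "x \<in> cycles A n"
  shows "(s \<ominus>\<^bsub>lev A n\<^esub> \<one>\<^bsub>lev A n\<^esub>) \<otimes>\<^bsub>lev A n\<^esub> x \<in> boundaries A n"
proof (rule kernel_pi0_mult_cycle[OF _ _ x])
  interpret V: ring_hom_cring "lev A n" "lev A 0" "vertex A n"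
    by (intro ring_hom_cring.intro ring_hom_cring_axioms.intro lev_cring vertex_hom)
  have sc: "s \<in> carrier (lev A n)" using s S_iff by blast
  then show "s \<ominus>\<^bsub>lev A n\<^esub> \<one>\<^bsub>lev A n\<^esub> \<in> carrier (lev A n)" by simp
  have "to_pi0 A n s = to_pi0 A n \<one>\<^bsub>lev A n\<^esub>"
    using s S_iff ring_hom_one[OF to_pi0_hom] by metis
  then have "vertex A n s \<ominus>\<^bsub>lev A 0\<^esub> vertex A n \<one>\<^bsub>lev A n\<^esub> \<in> boundaries A 0"
    using to_pi0_eq_iff[OF sc L.one_closed[of n]] by blast
  then show "vertex A n (s \<ominus>\<^bsub>lev A n\<^esub> \<one>\<^bsub>lev A n\<^esub>) \<in> boundaries A 0"
    using sc by (simp add: L.minus_eq)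
qed

text \<open>One face is treated at a time. A multiplier u for face k is lifted to the level above by
  a degeneracy that has u as its face k; the faces already killed stay zero because faces are
  multiplicative.\<close>

lemma clear_denominators:
  assumes a: "a \<in> carrier (lev A (Suc n))" and "I \<subseteq> {..Suc n}"
    and "\<And>i. i \<in> I \<Longrightarrow> \<exists>u\<in>S n. u \<otimes>\<^bsub>lev A n\<^esub> face A n i a = \<zero>\<^bsub>lev A n\<^esub>"
  shows "\<exists>t\<in>S (Suc n). \<forall>i\<in>I. face A n i (t \<otimes>\<^bsub>lev A (Suc n)\<^esub> a) = \<zero>\<^bsub>lev A n\<^esub>"
proof -
  have "finite I" using assms(2) finite_subset by blast
  then show ?thesis
    using assms(2,3)
  proof (induction I)
    case empty
    then show ?case using S_one[of "Suc n"] by blast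
  next
    case (insert k I)
    then obtain t where t: "t \<in> S (Suc n)" "\<forall>i\<in>I. face A n i (t \<otimes>\<^bsub>lev A (Suc n)\<^esub> a) = \<zero>\<^bsub>lev A n\<^esub>"
      by auto
    obtain u where u: "u \<in> S n" "u \<otimes>\<^bsub>lev A n\<^esub> face A n k a = \<zero>\<^bsub>lev A n\<^esub>"
      using insert.prems(2) by blast
    \<comment> \<open>Either j = k or j = k-1 gives d_k s_j u = u. The index must also satisfy 0 <=
      j <= n, which excludes k-1 for k = 0 and k for k = n+1.\<close>
    define j where "j = (if k = 0 then 0 else k - 1)"
    have k: "k \<le> Suc n" and j: "j \<le> n" using insert.prems(1) by (auto simp: j_def)
    have uc: "u \<in> carrier (lev A n)" using u by blast
    have kj: "face A n k (degen A n j u) = u"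
      using face_degen_same[OF j uc] face_degen_next[OF j uc] by (cases k) (auto simp: j_def)
    let ?t = "degen A n j u \<otimes>\<^bsub>lev A (Suc n)\<^esub> t"
    have tc: "t \<in> carrier (lev A (Suc n))" using t by blast
    have eq: "?t \<otimes>\<^bsub>lev A (Suc n)\<^esub> a = degen A n j u \<otimes>\<^bsub>lev A (Suc n)\<^esub> (t \<otimes>\<^bsub>lev A (Suc n)\<^esub> a)"
      using tc a uc j by (simp add: L.m_assoc)
    have "face A n i (?t \<otimes>\<^bsub>lev A (Suc n)\<^esub> a) = \<zero>\<^bsub>lev A n\<^esub>" if "i \<in> insert k I" for i
    proof (cases "i = k")
      case True
      have "face A n k (?t \<otimes>\<^bsub>lev A (Suc n)\<^esub> a)
          = face A n k t \<otimes>\<^bsub>lev A n\<^esub> (u \<otimes>\<^bsub>lev A n\<^esub> face A n k a)"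
        unfolding eq using tc a uc j k by (simp add: face_mult kj L.m_ac)
      then show ?thesis using True u(2) tc k by simp
    next
      case False
      then have "i \<in> I" "i \<le> Suc n" using that insert.prems(1) by auto
      then show ?thesis
        unfolding eq using face_mult[of i n "degen A n j u" "t \<otimes>\<^bsub>lev A (Suc n)\<^esub> a"] t(2) tc a uc j by simp
    qed
    moreover have "?t \<in> S (Suc n)" using S_degen[OF j u(1)] t(1) by (rule S_mult)
    ultimately show ?case by blast
  qed
qed

text \<open>A vanishing face of a/s only says that some element of S_n kills the face of the
  numerator. Expanding the fraction by the common multiplier makes the prescribed faces of the
  numerator vanish exactly.\<close>

lemma l_sring_faces_zero:
  assumes x: "x \<in> carrier (lev (l_sring A) (Suc n))" and I: "I \<subseteq> {..Suc n}"
    and zero: "\<And>i. i \<in> I \<Longrightarrow> face (l_sring A) n i x = \<zero>\<^bsub>lev (l_sring A) n\<^esub>"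
  obtains a s where "a \<in> carrier (lev A (Suc n))" "s \<in> S (Suc n)" "x = G (Suc n) a s"
    "\<And>i. i \<in> I \<Longrightarrow> face A n i a = \<zero>\<^bsub>lev A n\<^esub>"
proof -
  obtain a s where as: "a \<in> carrier (lev A (Suc n))" "s \<in> S (Suc n)" "x = G (Suc n) a s"
    using F.G_cases[OF x] .
  have "\<exists>u\<in>S n. u \<otimes>\<^bsub>lev A n\<^esub> face A n i a = \<zero>\<^bsub>lev A n\<^esub>" if i: "i \<in> I" for i
  proof -
    have "i \<le> Suc n" using i I by auto
    then show ?thesis
      using zero[OF i] as face_l_sring[of i n a s] F.G_eq_zero_iff[of "face A n i a" n "face A n i s"]
        S_face[of i n s] by simp
  qed
  then obtain t where t: "t \<in> S (Suc n)" "\<forall>i\<in>I. face A n i (t \<otimes>\<^bsub>lev A (Suc n)\<^esub> a) = \<zero>\<^bsub>lev A n\<^esub>"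
    using clear_denominators[OF as(1) I] by blast
  have tc: "t \<in> carrier (lev A (Suc n))" "s \<in> carrier (lev A (Suc n))" using t as by blast+
  show ?thesis
  proof (rule that)
    show "x = G (Suc n) (t \<otimes>\<^bsub>lev A (Suc n)\<^esub> a) (t \<otimes>\<^bsub>lev A (Suc n)\<^esub> s)"
      unfolding as(3) using as(1,2) t(1) tc by (intro F.G_eqI) (simp_all add: L.m_ac)
  qed (use as(1,2) t tc in auto)
qed

text \<open>Injectivity on pi_n. If x/1 = d_0(a/s) with \<open>a\<close> already cleared, then vx is
  a multiple of the boundary d_0 a for some v in S_n, and v acts as the identity modulo
  boundaries.\<close>

lemma l_unit_boundary_imp:
  assumes x: "x \<in> cycles A n" and bd: "l_unit A n x \<in> boundaries (l_sring A) n"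
  shows "x \<in> boundaries A n"
proof -
  have xc: "x \<in> carrier (lev A n)" using x by (rule cycles_carrier)
  obtain y where y: "y \<in> carrier (lev (l_sring A) (Suc n))" "G n x \<one>\<^bsub>lev A n\<^esub> = face (l_sring A) n 0 y"
    "\<And>i. i \<in> {1..Suc n} \<Longrightarrow> face (l_sring A) n i y = \<zero>\<^bsub>lev (l_sring A) n\<^esub>"
    using bd by (auto simp: boundaries_def l_unit_eq)
  have "{1..Suc n} \<subseteq> {..Suc n}" by auto
  then obtain a s where as: "a \<in> carrier (lev A (Suc n))" "s \<in> S (Suc n)" "y = G (Suc n) a s"
    "\<And>i. i \<in> {1..Suc n} \<Longrightarrow> face A n i a = \<zero>\<^bsub>lev A n\<^esub>"
    using l_sring_faces_zero[OF y(1) _ y(3)] by blast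
  have s: "face A n 0 s \<in> S n" and sc: "face A n 0 s \<in> carrier (lev A n)"
    using S_face[of 0 n s] as(2) by auto
  have "G n x \<one>\<^bsub>lev A n\<^esub> = G n (face A n 0 a) (face A n 0 s)"
    using y(2) as face_l_sring[of 0 n a s] by simp
  then obtain u where u: "u \<in> S n"
    "u \<otimes>\<^bsub>lev A n\<^esub> (x \<otimes>\<^bsub>lev A n\<^esub> face A n 0 s) = u \<otimes>\<^bsub>lev A n\<^esub> (face A n 0 a \<otimes>\<^bsub>lev A n\<^esub> \<one>\<^bsub>lev A n\<^esub>)"
    using F.G_eq_iff[of x n "face A n 0 a" "\<one>\<^bsub>lev A n\<^esub>" "face A n 0 s"] xc as(1) s
    by (auto simp: Q.frac_eq_def)
  have uc: "u \<in> carrier (lev A n)" using u by blast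
  define v where "v = u \<otimes>\<^bsub>lev A n\<^esub> face A n 0 s"
  have v: "v \<in> S n" and vc: "v \<in> carrier (lev A n)" using u s uc sc by (auto simp: v_def)
  have "face A n 0 a \<in> boundaries A n" using as by (intro boundariesI) auto
  then have "u \<otimes>\<^bsub>lev A n\<^esub> face A n 0 a \<in> boundaries A n" using uc by (rule Bd.I_l_closed)
  moreover have "u \<otimes>\<^bsub>lev A n\<^esub> face A n 0 a = v \<otimes>\<^bsub>lev A n\<^esub> x"
    using u(2) uc sc xc as(1) by (simp add: v_def L.m_ac)
  ultimately have "v \<otimes>\<^bsub>lev A n\<^esub> x \<in> boundaries A n" by simp
  \<comment> \<open>x = vx - (v-1)x, a difference of two boundaries.\<close>
  then have "v \<otimes>\<^bsub>lev A n\<^esub> x \<oplus>\<^bsub>lev A n\<^esub> \<ominus>\<^bsub>lev A n\<^esub> ((v \<ominus>\<^bsub>lev A n\<^esub> \<one>\<^bsub>lev A n\<^esub>) \<otimes>\<^bsub>lev A n\<^esub> x) \<in> boundaries A n"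
    using S_mult_cycle[OF v x] by simp
  moreover have "v \<otimes>\<^bsub>lev A n\<^esub> x \<oplus>\<^bsub>lev A n\<^esub> \<ominus>\<^bsub>lev A n\<^esub> ((v \<ominus>\<^bsub>lev A n\<^esub> \<one>\<^bsub>lev A n\<^esub>) \<otimes>\<^bsub>lev A n\<^esub> x) = x"
    using vc xc by (simp add: L.minus_eq L.l_distr L.l_minus L.minus_add L.r_neg1 L.r_neg2)
  ultimately show ?thesis by simp
qed

text \<open>Surjectivity on pi_n. A cycle is a/s with a cycle \<open>a\<close> as numerator, and a/1
  already represents its class: a/1 - a/s = (s-1)a/s, where (s-1)a is a boundary in A.\<close>

lemma l_unit_surj_cycles:
  assumes y: "y \<in> cycles (l_sring A) n"
  shows "\<exists>x\<in>cycles A n. l_unit A n x \<ominus>\<^bsub>lev (l_sring A) n\<^esub> y \<in> boundaries (l_sring A) n"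
proof -
  interpret C: cring "lev (l_sring A) n" by (rule F.cring_B)
  have yc: "y \<in> carrier (lev (l_sring A) n)" using y by (simp add: cycles_def)
  obtain a s where a: "a \<in> cycles A n" and s: "s \<in> S n" and y_eq: "y = G n a s"
  proof (cases n)
    \<comment> \<open>No face condition exists in degree 0, so the numerator of any representation
      is a cycle.\<close>
    case 0
    obtain a s where "a \<in> carrier (lev A n)" "s \<in> S n" "y = G n a s"
      using F.G_cases[OF yc] .
    then show ?thesis using 0 by (intro that[of a s]) (auto simp: cycles_def)
  next
    case (Suc m)
    have yc': "y \<in> carrier (lev (l_sring A) (Suc m))" using yc Suc by simp
    have "face (l_sring A) m i y = \<zero>\<^bsub>lev (l_sring A) m\<^esub>" if "i \<in> {..Suc m}" for i
      using y Suc that by (simp add: cycles_def)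
    then obtain a s where "a \<in> carrier (lev A (Suc m))" "s \<in> S (Suc m)" "y = G (Suc m) a s"
      "\<And>i. i \<in> {..Suc m} \<Longrightarrow> face A m i a = \<zero>\<^bsub>lev A m\<^esub>"
      using l_sring_faces_zero[OF yc' subset_refl] by blast
    then show ?thesis using Suc by (intro that[of a s]) (auto simp: cycles_def)
  qed
  have ac: "a \<in> carrier (lev A n)" and sc: "s \<in> carrier (lev A n)"
    using a cycles_carrier s by blast+
  let ?d = "(s \<ominus>\<^bsub>lev A n\<^esub> \<one>\<^bsub>lev A n\<^esub>) \<otimes>\<^bsub>lev A n\<^esub> a"
  have dc: "?d \<in> carrier (lev A n)" using ac sc by simp
  obtain w where w: "w \<in> carrier (lev A (Suc n))" "?d = face A n 0 w"
    "\<And>i. \<lbrakk>1 \<le> i; i \<le> Suc n\<rbrakk> \<Longrightarrow> face A n i w = \<zero>\<^bsub>lev A n\<^esub>"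
    using boundariesE[OF S_mult_cycle[OF s a]] by blast
  have ds: "degen A n 0 s \<in> S (Suc n)" using S_degen[OF _ s] by simp
  \<comment> \<open>The denominator s_0 s is chosen for its face 0, which is \<open>s\<close>, so
    that d_0 of the fraction is (s-1)a/s.\<close>
  let ?w = "G (Suc n) w (degen A n 0 s)"
  have "face (l_sring A) n i ?w = \<zero>\<^bsub>lev (l_sring A) n\<^esub>" if "1 \<le> i" "i \<le> Suc n" for i
    using that w ds F.G_eq_zero_iff[of "\<zero>\<^bsub>lev A n\<^esub>" n "face A n i (degen A n 0 s)"] S_one[of n]
      S_face[OF that(2) ds] by (auto simp: face_l_sring)
  then have "face (l_sring A) n 0 ?w \<in> boundaries (l_sring A) n"
    unfolding boundaries_def using F.G_closed[OF w(1) ds] by blast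
  moreover have "face (l_sring A) n 0 ?w = G n ?d s"
    using w ds sc by (simp add: face_l_sring face_degen_same)
  moreover have "G n a \<one>\<^bsub>lev A n\<^esub> = G n ?d s \<oplus>\<^bsub>lev (l_sring A) n\<^esub> y"
  proof -
    have "?d \<oplus>\<^bsub>lev A n\<^esub> a = s \<otimes>\<^bsub>lev A n\<^esub> a"
      using ac sc by (simp add: L.minus_eq L.l_distr L.l_minus L.a_assoc L.l_neg)
    moreover have "?d \<otimes>\<^bsub>lev A n\<^esub> s \<oplus>\<^bsub>lev A n\<^esub> a \<otimes>\<^bsub>lev A n\<^esub> s = (?d \<oplus>\<^bsub>lev A n\<^esub> a) \<otimes>\<^bsub>lev A n\<^esub> s"
      using ac sc dc by (simp add: L.l_distr)
    ultimately have d: "?d \<otimes>\<^bsub>lev A n\<^esub> s \<oplus>\<^bsub>lev A n\<^esub> a \<otimes>\<^bsub>lev A n\<^esub> s = a \<otimes>\<^bsub>lev A n\<^esub> (s \<otimes>\<^bsub>lev A n\<^esub> s)"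
      using ac sc by (simp add: L.m_ac)
    show ?thesis
      unfolding y_eq F.G_add[OF dc ac s s] d
      using ac sc s S_one[of n] S_mult[OF s s] by (intro F.G_eqI) simp_all
  qed
  then have "G n a \<one>\<^bsub>lev A n\<^esub> \<ominus>\<^bsub>lev (l_sring A) n\<^esub> y = G n ?d s"
    using yc F.G_closed[OF dc s] by (simp add: C.minus_eq C.a_assoc C.r_neg)
  ultimately show ?thesis using a by (intro bexI[of _ a]) (simp_all add: l_unit_eq)
qed

end

text \<open>Injectivity and surjectivity are hypotheses on representatives. \<open>f\<close>
  followed by the quotient map sends cycles onto the homotopy group of \<open>B\<close>, with
  exactly the boundaries of \<open>A\<close> as kernel, so the first isomorphism theorem
  applies.\<close>

lemma homotopy_map_iso:
  assumes A: "simplicial_cring A" and B: "simplicial_cring B" and f: "sring_hom A B f"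
    and inj: "\<And>x. \<lbrakk>x \<in> cycles A n; f n x \<in> boundaries B n\<rbrakk> \<Longrightarrow> x \<in> boundaries A n"
    and surj: "\<And>y. y \<in> cycles B n \<Longrightarrow> \<exists>x\<in>cycles A n. f n x \<ominus>\<^bsub>lev B n\<^esub> y \<in> boundaries B n"
  shows "homotopy_map B f n \<in> iso (homotopy_group A n) (homotopy_group B n)"
proof -
  interpret A: simplicial_cring A by (rule A)
  interpret B: simplicial_cring B by (rule B)
  interpret f: ring_hom_cring "lev A m" "lev B m" "f m" for m
    using f by (intro ring_hom_cring.intro ring_hom_cring_axioms.intro A.lev_cring B.lev_cring)
      (simp add: sring_hom_def)
  have f_face: "f m (face A m i x) = face B m i (f (Suc m) x)"
    if "x \<in> carrier (lev A (Suc m))" "i \<le> Suc m" for m i x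
    using f that by (simp add: sring_hom_def)
  let ?ZA = "add_monoid (lev A n)\<lparr>carrier := cycles A n\<rparr>"
  let ?ZB = "add_monoid (lev B n)\<lparr>carrier := cycles B n\<rparr>"
  interpret ZA: comm_group ?ZA
    by (rule group.group_comm_groupI[OF A.L.add.subgroup_imp_group[OF A.subgroup_cycles]])
      (simp add: A.L.a_comm A.cycles_carrier)
  interpret ZB: comm_group ?ZB
    by (rule group.group_comm_groupI[OF B.L.add.subgroup_imp_group[OF B.subgroup_cycles]])
      (simp add: B.L.a_comm B.cycles_carrier)
  have sgA: "subgroup (boundaries A n) ?ZA"
    using A.L.add.subgroup_incl[OF A.Bd.a_subgroup A.subgroup_cycles A.boundaries_subset_cycles] .
  have sgB: "subgroup (boundaries B n) ?ZB"
    using B.L.add.subgroup_incl[OF B.Bd.a_subgroup B.subgroup_cycles B.boundaries_subset_cycles] .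
  interpret NB: normal "boundaries B n" ?ZB by (rule ZB.subgroup_imp_normal[OF sgB])
  interpret NA: normal "boundaries A n" ?ZA by (rule ZA.subgroup_imp_normal[OF sgA])
  have f_cycle: "f n x \<in> cycles B n" if x: "x \<in> cycles A n" for x
  proof -
    have "face B m i (f n x) = \<zero>\<^bsub>lev B m\<^esub>" if "n = Suc m" "i \<le> n" for m i
      using that x f_face[of x m i] A.cycles_carrier[OF x] A.cycles_face[of x m i] by simp
    then show ?thesis using A.cycles_carrier[OF x] by (simp add: cycles_def)
  qed
  have f_bd: "f n x \<in> boundaries B n" if x: "x \<in> boundaries A n" for x
  proof -
    obtain y where y: "y \<in> carrier (lev A (Suc n))" "x = face A n 0 y"
      "\<And>i. \<lbrakk>1 \<le> i; i \<le> Suc n\<rbrakk> \<Longrightarrow> face A n i y = \<zero>\<^bsub>lev A n\<^esub>"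
      using A.boundariesE[OF x] by blast
    have "face B n i (f (Suc n) y) = \<zero>\<^bsub>lev B n\<^esub>" if "1 \<le> i" "i \<le> Suc n" for i
      using f_face[OF y(1) that(2)] y(3)[OF that] by simp
    then have "face B n 0 (f (Suc n) y) \<in> boundaries B n"
      using y by (intro B.boundariesI) simp_all
    then show ?thesis using f_face[OF y(1), of 0] y(2) by simp
  qed
  have f_hom: "f n \<in> hom ?ZA ?ZB"
    using f_cycle A.cycles_carrier by (auto simp: hom_def)
  define h where "h x = boundaries B n #>\<^bsub>?ZB\<^esub> f n x" for x
  have h_eq: "h x = boundaries B n +>\<^bsub>lev B n\<^esub> f n x" for x
    by (simp add: h_def a_r_coset_def r_coset_def)
  have "h = (\<lambda>x. boundaries B n #>\<^bsub>?ZB\<^esub> x) \<circ> f n" by (rule ext) (simp add: h_def)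
  then have h_hom: "h \<in> hom ?ZA (?ZB Mod boundaries B n)"
    using Group.hom_compose[OF f_hom NB.r_coset_hom_Mod] by (simp only:)
  interpret h: group_hom ?ZA "?ZB Mod boundaries B n" h
    using h_hom by (intro group_hom.intro group_hom_axioms.intro ZA.is_group NB.factorgroup_is_group)
  have h_eq_iff: "h x = boundaries B n +>\<^bsub>lev B n\<^esub> y \<longleftrightarrow> f n x \<ominus>\<^bsub>lev B n\<^esub> y \<in> boundaries B n"
    if "x \<in> cycles A n" "y \<in> cycles B n" for x y
    unfolding h_eq using that f_cycle A.cycles_carrier B.cycles_carrier
      B.L.quotient_eq_iff_same_a_r_cos[OF B.ideal_boundaries] by blast
  have one: "\<one>\<^bsub>?ZB Mod boundaries B n\<^esub> = boundaries B n +>\<^bsub>lev B n\<^esub> \<zero>\<^bsub>lev B n\<^esub>"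
    using B.Bd.a_subset by (simp add: FactGroup_def)
  have kernel: "kernel ?ZA (?ZB Mod boundaries B n) h = boundaries A n"
  proof -
    have "h x = \<one>\<^bsub>?ZB Mod boundaries B n\<^esub> \<longleftrightarrow> f n x \<in> boundaries B n" if x: "x \<in> cycles A n" for x
    proof -
      have "\<zero>\<^bsub>lev B n\<^esub> \<in> cycles B n" using B.boundaries_subset_cycles B.Bd.zero_closed by blast
      then show ?thesis
        unfolding one using h_eq_iff[OF x] A.cycles_carrier[OF x] by (simp add: B.L.minus_eq)
    qed
    moreover have "f n x \<in> boundaries B n \<longleftrightarrow> x \<in> boundaries A n" if "x \<in> cycles A n" for x
      using inj f_bd that by blast
    ultimately have "x \<in> kernel ?ZA (?ZB Mod boundaries B n) h \<longleftrightarrow> x \<in> cycles A n \<and> x \<in> boundaries A n" for x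
      unfolding kernel_def by (cases "x \<in> cycles A n") simp_all
    then show ?thesis using A.boundaries_subset_cycles by blast
  qed
  have onto: "h ` carrier ?ZA = carrier (?ZB Mod boundaries B n)"
  proof
    show "carrier (?ZB Mod boundaries B n) \<subseteq> h ` carrier ?ZA"
    proof
      fix C assume "C \<in> carrier (?ZB Mod boundaries B n)"
      then obtain y where y: "y \<in> cycles B n" "C = boundaries B n +>\<^bsub>lev B n\<^esub> y"
        by (auto simp: FactGroup_def RCOSETS_def a_r_coset_def r_coset_def)
      obtain x where "x \<in> cycles A n" "f n x \<ominus>\<^bsub>lev B n\<^esub> y \<in> boundaries B n" using surj y by blast
      then show "C \<in> h ` carrier ?ZA" using h_eq_iff y by auto
    qed
  qed (use h.hom_closed in blast)
  \<comment> \<open>The map supplied takes a coset to the single element of its image under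
    \<open>h\<close>, whereas \<open>homotopy_map\<close> takes the union of that image. The two
    agree on cosets because \<open>h\<close> is constant there.\<close>
  have iso: "(\<lambda>X. the_elem (h ` X)) \<in> iso (?ZA Mod boundaries A n) (?ZB Mod boundaries B n)"
    using h.FactGroup_iso_set[OF onto] unfolding kernel .
  have eq: "the_elem (h ` C) = homotopy_map B f n C" if C: "C \<in> carrier (?ZA Mod boundaries A n)" for C
  proof -
    obtain x where x: "x \<in> cycles A n" "C = boundaries A n #>\<^bsub>?ZA\<^esub> x"
      using C by (auto simp: FactGroup_def RCOSETS_def)
    have "h z = h x" if z: "z \<in> C" for z
    proof -
      obtain b where b: "b \<in> boundaries A n" "z = b \<oplus>\<^bsub>lev A n\<^esub> x"
        using z x by (auto simp: r_coset_def)
      have bc: "b \<in> cycles A n" using b A.boundaries_subset_cycles by blast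
      have "h b = \<one>\<^bsub>?ZB Mod boundaries B n\<^esub>"
        using b(1) unfolding kernel[symmetric] by (simp add: kernel_def)
      then show ?thesis using h.hom_mult[of b x] bc x b(2) h.hom_closed[of x] h.H.l_one by simp
    qed
    moreover have "x \<in> C" using ZA.rcos_self[OF _ sgA] x by simp
    ultimately have img: "h ` C = {h x}" by blast
    have "homotopy_map B f n C = \<Union>(h ` C)" by (simp add: homotopy_map_def h_eq)
    then show ?thesis by (simp add: img)
  qed
  have grA: "Group.group (?ZA Mod boundaries A n)" by (rule NA.factorgroup_is_group)
  have "homotopy_map B f n \<in> hom (?ZA Mod boundaries A n) (?ZB Mod boundaries B n)"
  proof (rule homI)
    fix X Y assume XY: "X \<in> carrier (?ZA Mod boundaries A n)" "Y \<in> carrier (?ZA Mod boundaries A n)"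
    show "homotopy_map B f n X \<in> carrier (?ZB Mod boundaries B n)"
      unfolding eq[OF XY(1), symmetric]
      by (rule hom_in_carrier[OF iso_imp_homomorphism[OF iso] XY(1)])
    show "homotopy_map B f n (X \<otimes>\<^bsub>?ZA Mod boundaries A n\<^esub> Y)
        = homotopy_map B f n X \<otimes>\<^bsub>?ZB Mod boundaries B n\<^esub> homotopy_map B f n Y"
      \<comment> \<open>Agreement of the two maps is known on the carrier alone, so the product must
        be shown to lie in it before the homomorphism law can be transferred.\<close>
      unfolding eq[OF monoid.m_closed[OF group.is_monoid[OF grA] XY], symmetric]
        eq[OF XY(1), symmetric] eq[OF XY(2), symmetric]
      by (rule hom_mult[OF iso_imp_homomorphism[OF iso] XY])
  qed
  moreover have "bij_betw (homotopy_map B f n) (carrier (?ZA Mod boundaries A n)) (carrier (?ZB Mod boundaries B n))"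
    using iso bij_betw_cong[of "carrier (?ZA Mod boundaries A n)", OF eq] by (auto simp: iso_def)
  ultimately show ?thesis by (simp add: iso_def homotopy_group_def)
qed

theorem proposition6p11:
  fixes A :: "'a sring"
  assumes "simplicial_cring A"
  shows "weak_equivalence A (l_sring A) (l_unit A)"
proof -
  interpret simplicial_cring A by (rule assms)
  show ?thesis
    unfolding weak_equivalence_def
    using assms simplicial_cring_l_sring sring_hom_l_unit
      homotopy_map_iso[OF assms simplicial_cring_l_sring sring_hom_l_unit
        l_unit_boundary_imp l_unit_surj_cycles]
    by blast
qed

end
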